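(* Consider $N$ agents, of which $f\ge 1$ are Byzantine and the remaining ones form the set $\mathcal{H}$ of honest agents, $|\mathcal{H}|=N-f$. Let each honest agent $i\in\mathcal{H}$ have a differentiable local cost $q^i:\mathbb{R}^d\to\mathbb{R}$, and let $q^{\mathcal{H}}(x)=\frac{1}{|\mathcal{H}|}\sum_{i\in\mathcal{H}}q^i(x)$. Assume: (i) ($2f$-redundancy) for every $\mathcal{S}\subset\mathcal{H}$ with $|\mathcal{S}|\ge N-2f$, $\arg\min_{x\in\mathbb{R}^d}\sum_{i\in\mathcal{S}}q^i(x)=\arg\min_{x\in\mathbb{R}^d}\sum_{i\in\mathcal{H}}q^i(x)$; let $x^*_{\mathcal{H}}$ be an element of $\arg\min_{x}\sum_{i\in\mathcal{H}}q^i(x)$ (assumed nonempty). (ii) (Lipschitz smoothness) for some $L>0$ and every $i\in\mathcal{H}$, $\nabla q^i$ is $L$-Lipschitz continuous, so that $q^i(y)-q^i(x)\le\nabla q^i(x)^T(y-x)+\frac{L}{2}\|y-x\|^2$ for all $x,y\in\mathbb{R}^d$. (iii) (PL condition and quadratic growth) for some $\mu>0$ and all $x\in\mathbb{R}^d$, $\|\nabla q^{\mathcal{H}}(x)\|^2\ge 2\mu\,(q^{\mathcal{H}}(x)-q^{\mathcal{H}}(x^*_{\mathcal{H}}))\ge\mu^2\|x-x^*_{\mathcal{H}}\|^2$. (iv) (stochastic gradients) the random samples $\Delta^i_{k,t}$ are i.i.d. and there is a constant $\sigma>0$ such that for all $i\in\mathcal{H}$, $k\ge 0$, $0\le t\le\mathcal{T}-1$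 and all $x$, $\mathbb{E}[\nabla Q^i(x;\Delta^i_{k,t})\mid\mathcal{P}_{k,t}]=\nabla q^i(x)$ and $\mathbb{E}[\|\nabla Q^i(x;\Delta^i_{k,t})-\nabla q^i(x)\|^2\mid\mathcal{P}_{k,t}]\le\sigma^2$. Let $\{\bar{x}_k\}_{k\ge 0}$ be generated by federated local SGD with the comparative elimination (CE) filter (defined in the context), with $\mathcal{T}\ge 1$ local steps and constant step size $$\alpha_k=\alpha,\qquad 0<\alpha\le\frac{\mu}{72L^2\mathcal{T}}.$$ If $$\frac{f}{N-f}\le\frac{\mu}{3L},$$ then, whatever the Byzantine agents send, for every $k\ge 0$, $$\mathbb{E}[q^{\mathcal{H}}(\bar{x}_{k+1})-q^{\mathcal{H}}(x^*_{\mathcal{H}})]\le\Big(1-\frac{\alpha\mu\mathcal{T}}{36}\Big)^{k+1}\mathbb{E}[q^{\mathcal{H}}(\bar{x}_0)-q^{\mathcal{H}}(x^*_{\mathcal{H}})]+\frac{180L\mathcal{T}\alpha\sigma^2}{\mu}+\frac{72\mathcal{T}\sigma^2 f}{\mu|\mathcal{H}|}.$$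
   Context: Federated local SGD with CE filter. The server holds an initial point $\bar{x}_0\in\mathbb{R}^d$. At each global iteration $k=0,1,2,\dots$: 1. Every honest agent $i\in\mathcal{H}$ receives $\bar{x}_k$, sets $x^i_{k,0}=\bar{x}_k$, and for $t=0,\dots,\mathcal{T}-1$ performs $x^i_{k,t+1}=x^i_{k,t}-\alpha_k\nabla Q^i(x^i_{k,t};\Delta^i_{k,t})$, where $\nabla Q^i(\cdot\,;\Delta^i_{k,t})$ is a stochastic sample of its local gradient. It sends $x^i_{k,\mathcal{T}}$ to the server. 2. Every Byzantine agent $i\notin\mathcal{H}$ sends an arbitrary (random) vector, also denoted $x^i_{k,\mathcal{T}}\in\mathbb{R}^d$, to the server; Byzantine agents may observe the entire network, and their identities are unknown to the server. 3. (CE filter) The server sorts the agents so that $\|\bar{x}_k-x^{i_1}_{k,\mathcal{T}}\|\le\|\bar{x}_k-x^{i_2}_{k,\mathcal{T}}\|\le\cdots\le\|\bar{x}_k-x^{i_N}_{k,\mathcal{T}}\|$, discards the $f$ agents with the largest distances, keeps $\mathcal{F}_k=\{i_1,\dots,i_{N-f}\}$, and sets $\bar{x}_{k+1}=\frac{1}{|\mathcal{F}_k|}\sum_{i\in\mathcal{F}_k}x^i_{k,\mathcal{T}}$. $\mathcal{P}_{k,t}$ denotes the history (the $\sigma$-algebra) generated by $\bar{x}_0,\dots,\bar{x}_k$ and $x^i_{k,1},\dots,x^i_{k,t}$ for all $i\in\mathcal{H}$. The conditional moment conditions on the stochastic gradients are understood to apply at $\mathcal{P}_{k,t}$-measurable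 points $x$ as well, in particular at $x=x^i_{k,t}$. $\|\cdot\|$ is the Euclidean norm. *)

theory Defs
  imports "HOL-Probability.Probability"
begin

definition argmin :: "('a \<Rightarrow> real) \<Rightarrow> 'a set" where
  "argmin g = {x. is_arg_min g (\<lambda>_. True) x}"

definition grad :: "('a::real_inner \<Rightarrow> real) \<Rightarrow> 'a \<Rightarrow> 'a" where
  "grad g x = (THE D. GDERIV g x :> D)"

lemma grad_eq:
  assumes "GDERIV g x :> D"
  shows "grad g x = D"
  unfolding grad_def
proof (rule the_equality)
  show "GDERIV g x :> D"
    by (rule assms)
next
  fix E
  assume "GDERIV g x :> E"
  then have "(\<lambda>h. inner h E) = (\<lambda>h. inner h D)"
    using assms unfolding gderiv_def by (rule has_derivative_unique)
  then have "inner (E - D) (E - D) = 0"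
    by (metis inner_diff_right right_minus_eq)
  then show "E = D"
    by simp
qed

definition avg_cost :: "nat set \<Rightarrow> (nat \<Rightarrow> 'a \<Rightarrow> real) \<Rightarrow> 'a \<Rightarrow> real" where
  "avg_cost H q x = (1 / real (card H)) * (\<Sum>i\<in>H. q i x)"

text \<open>
  One aggregation step of the server with agents \<open>1, \<dots>, N\<close>: \<open>z\<close> is a possible new iterate if the
  current iterate is \<open>c\<close> and agent \<open>i\<close> has sent \<open>y i\<close>. Equal distances may be ordered arbitrarily,
  so this is a relation between \<open>y\<close> and \<open>z\<close> rather than a function.
\<close>

definition ce_step ::
  "nat \<Rightarrow> nat \<Rightarrow> 'a::real_normed_vector \<Rightarrow> (nat \<Rightarrow> 'a) \<Rightarrow> 'a \<Rightarrow> bool" where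
  "ce_step N f c y z \<longleftrightarrow>
     (\<exists>ord. distinct ord \<and> set ord = {1..N} \<and> sorted (map (\<lambda>i. norm (c - y i)) ord) \<and>
        (let F = set (take (N - f) ord) in z = (1 / real (card F)) *\<^sub>R (\<Sum>i\<in>F. y i)))"

text \<open>
  The history at global iteration \<open>k\<close> and local step \<open>t\<close>: the \<open>\<sigma>\<close>-algebra generated by
  \<open>xb 0, \<dots>, xb k\<close> and by \<open>x i k 1, \<dots>, x i k t\<close> for \<open>i \<in> H\<close>, as a measure space on \<open>space M\<close>.
\<close>

definition history ::
  "'w measure \<Rightarrow> nat set \<Rightarrow> (nat \<Rightarrow> 'w \<Rightarrow> 'a::topological_space) \<Rightarrow>
     (nat \<Rightarrow> nat \<Rightarrow> nat \<Rightarrow> 'w \<Rightarrow> 'a) \<Rightarrow> nat \<Rightarrow> nat \<Rightarrow> 'w measure" where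
  "history M H xb x k t =
     sigma (space M)
       ({xb j -` A \<inter> space M | j A. j \<le> k \<and> A \<in> sets borel} \<union>
        {x i k s -` A \<inter> space M | i s A. i \<in> H \<and> 1 \<le> s \<and> s \<le> t \<and> A \<in> sets borel})"

text \<open>The library has conditional expectations for real functions only; vectors are treated
  componentwise.\<close>

definition vec_cond_exp ::
  "'w measure \<Rightarrow> 'w measure \<Rightarrow> ('w \<Rightarrow> real ^ 'n) \<Rightarrow> 'w \<Rightarrow> real ^ 'n" where
  "vec_cond_exp M F g \<omega> = (\<chi> j. real_cond_exp M F (\<lambda>\<omega>'. g \<omega>' $ j) \<omega>)"

text \<open>
  The conditional moment conditions on a stochastic gradient \<open>g (\<cdot>) (D \<omega>)\<close> of the cost \<open>h\<close>, at
  every \<open>F\<close>-measurable point \<open>X\<close>; constant points are included. The second moment is a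
  conditional expectation with values in \<^typ>\<open>ennreal\<close>, because \<^const>\<open>real_cond_exp\<close> would turn an
  infinite one into 0. Together with its bound it makes the conditional mean well defined
  and finite, even when \<open>g (X \<omega>) (D \<omega>)\<close> itself is not integrable.
\<close>

definition stoch_grad ::
  "'w measure \<Rightarrow> 'w measure \<Rightarrow> (real ^ 'n \<Rightarrow> real) \<Rightarrow> (real ^ 'n \<Rightarrow> 's \<Rightarrow> real ^ 'n) \<Rightarrow>
     ('w \<Rightarrow> 's) \<Rightarrow> real \<Rightarrow> bool" where
  "stoch_grad M F h g D \<sigma> \<longleftrightarrow>
     (\<forall>X \<in> F \<rightarrow>\<^sub>M borel.
        (AE \<omega> in M. vec_cond_exp M F (\<lambda>\<omega>. g (X \<omega>) (D \<omega>)) \<omega> = grad h (X \<omega>)) \<and>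
        (AE \<omega> in M. nn_cond_exp M F (\<lambda>\<omega>. ennreal ((norm (g (X \<omega>) (D \<omega>) - grad h (X \<omega>)))\<^sup>2)) \<omega>
                     \<le> ennreal (\<sigma>\<^sup>2)))"

end

theory Submission
  imports Defs
begin

text \<open>
  By redundancy, \<open>xs\<close> minimises both \<open>\<Sum>j\<in>H. q j\<close> and \<open>\<Sum>j\<in>H - {i}. q j\<close>, so every honest gradient
  vanishes at \<open>xs\<close> and local steps from \<open>c\<close> have length of order \<open>\<alpha> L \<parallel>c - xs\<parallel>\<close>. A Byzantine message that
  survives the filter is at most as far from \<open>c\<close> as a discarded honest one; pairing the two kinds
  bounds the filtering error by \<open>2 f / (N - f)\<close> times an honest displacement, and
  \<open>\<mu> \<parallel>c - xs\<parallel> \<le> \<parallel>\<nabla>q\<parallel>\<close> together with \<open>f / (N - f) \<le> \<mu> / (3 L)\<close> makes this at most about two thirds of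
  the averaged gradient step. The remaining third survives the drift and smoothness errors, which
  gives a pathwise contraction of the optimality gap up to squares of the gradient noise and one
  linear noise term. The latter has mean zero, since the noise is conditionally centred given the history.
\<close>

subsection \<open>Gradients\<close>

text \<open>In finite dimension the derivative, being linear, is the inner product with the vector
  assembled from its values on \<open>Basis\<close>; \<open>grad_eq\<close> then identifies this
  vector with the one selected by \<open>THE\<close> in \<open>grad\<close>.\<close>

lemma GDERIV_grad:
  fixes g :: "'a::euclidean_space \<Rightarrow> real"
  assumes "g differentiable (at x)"
  shows "GDERIV g x :> grad g x"
proof -
  obtain D where D: "(g has_derivative D) (at x)"
    using assms by (auto simp: differentiable_def)
  then have "linear D"
    by (rule has_derivative_linear)
  have "D h = h \<bullet> (\<Sum>b\<in>Basis. D b *\<^sub>R b)" for h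
  proof -
    have "D h = D (\<Sum>b\<in>Basis. (h \<bullet> b) *\<^sub>R b)"
      by (simp add: euclidean_representation)
    also have "\<dots> = h \<bullet> (\<Sum>b\<in>Basis. D b *\<^sub>R b)"
      using \<open>linear D\<close> by (simp add: linear_sum linear_scale inner_sum_right mult.commute)
    finally show ?thesis .
  qed
  then have "D = (\<lambda>h. h \<bullet> (\<Sum>b\<in>Basis. D b *\<^sub>R b))"
    by (rule ext)
  with D have "GDERIV g x :> (\<Sum>b\<in>Basis. D b *\<^sub>R b)"
    unfolding gderiv_def by (rule back_subst)
  then show ?thesis
    by (metis grad_eq)
qed

text \<open>Along the segment from \<open>x\<close> to \<open>y\<close>, \<open>\<psi>\<close> is
  the function minus its quadratic model, up to the constant. Cauchy-Schwarz and the Lipschitz bound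
  make its derivative nonpositive, and the claim is \<open>\<psi> 1 \<le> \<psi> 0\<close>.\<close>

lemma GDERIV_descent:
  fixes \<phi> :: "'a::real_inner \<Rightarrow> real"
  assumes deriv: "\<And>y. GDERIV \<phi> y :> g y"
    and lip: "L-lipschitz_on UNIV g"
  shows "\<phi> y \<le> \<phi> x + g x \<bullet> (y - x) + L / 2 * (norm (y - x))\<^sup>2"
proof -
  define v where "v = y - x"
  define \<psi> where "\<psi> s = \<phi> (x + s *\<^sub>R v) - s * (g x \<bullet> v) - L / 2 * s\<^sup>2 * (norm v)\<^sup>2" for s
  have "\<psi> 1 \<le> \<psi> 0"
  proof (rule DERIV_nonpos_imp_nonincreasing[where f = \<psi> and a = 0 and b = 1])
    fix s :: real
    assume "0 \<le> s" "s \<le> 1"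
    have "((\<lambda>s. x + s *\<^sub>R v) has_derivative (\<lambda>h. h *\<^sub>R v)) (at s)"
      by (auto intro!: derivative_eq_intros)
    from has_derivative_compose[OF this deriv[of "x + s *\<^sub>R v", unfolded gderiv_def]]
    have "((\<lambda>s. \<phi> (x + s *\<^sub>R v)) has_real_derivative (g (x + s *\<^sub>R v) \<bullet> v)) (at s)"
      by (simp add: has_field_derivative_def inner_commute mult_commute_abs)
    then have der: "(\<psi> has_real_derivative
        (g (x + s *\<^sub>R v) \<bullet> v - g x \<bullet> v - L * s * (norm v)\<^sup>2)) (at s)"
      unfolding \<psi>_def by (auto intro!: derivative_eq_intros)
    have "g (x + s *\<^sub>R v) \<bullet> v - g x \<bullet> v = (g (x + s *\<^sub>R v) - g x) \<bullet> v"
      by (simp add: inner_diff_left)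
    also have "\<dots> \<le> norm (g (x + s *\<^sub>R v) - g x) * norm v"
      by (rule norm_cauchy_schwarz)
    also have "\<dots> \<le> (L * norm (s *\<^sub>R v)) * norm v"
      using lipschitz_onD[OF lip, of "x + s *\<^sub>R v" x]
      by (intro mult_right_mono) (auto simp: dist_norm)
    also have "\<dots> = L * s * (norm v)\<^sup>2"
      using \<open>0 \<le> s\<close> by (simp add: power2_eq_square)
    finally show "\<exists>l. (\<psi> has_real_derivative l) (at s) \<and> l \<le> 0"
      using der by (intro exI[of _ "g (x + s *\<^sub>R v) \<bullet> v - g x \<bullet> v - L * s * (norm v)\<^sup>2"]) simp
  qed simp
  then show ?thesis
    by (simp add: \<psi>_def v_def)
qed

lemma GDERIV_minimizer:
  assumes "GDERIV g s :> D" "s \<in> argmin g"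
  shows "D = 0"
proof -
  have "\<And>y. g s \<le> g y"
    using assms(2) by (auto simp: argmin_def is_arg_min_def not_less)
  then have "(\<lambda>h. h \<bullet> D) = (\<lambda>h. 0)"
    using assms(1) unfolding gderiv_def
    by (intro has_derivative_local_min) auto
  then have "D \<bullet> D = 0"
    by meson
  then show ?thesis
    by simp
qed

subsection \<open>The pathwise descent inequality\<close>

text \<open>The kept set \<open>F\<close> and \<open>H\<close> have the same size, so kept Byzantine
  agents can be paired with discarded honest ones, which are at least as far from \<open>c\<close>.
  The factor 2 counts the wrongly kept and the wrongly dropped displacements. The witness is
  \<open>D = H - F\<close>; keeping the sum over \<open>D\<close>, instead of a maximum, lets the
  noise of the discarded agents be estimated with a factor \<open>f\<close> later.\<close>

lemma ce_step_error:
  fixes c z :: "'a::real_normed_vector"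
  assumes ce: "ce_step N f c y z"
    and H: "H \<subseteq> {1..N}" "card H = N - f" and N: "f < N"
  obtains D where "D \<subseteq> H" "card D \<le> f"
    and "norm (z - c - (1 / real (N - f)) *\<^sub>R (\<Sum>j\<in>H. y j - c))
           \<le> 2 / real (N - f) * (\<Sum>j\<in>D. norm (y j - c))"
proof -
  from ce obtain ord where ord: "distinct ord" "set ord = {1..N}"
      "sorted (map (\<lambda>i. norm (c - y i)) ord)"
      "z = (1 / real (card (set (take (N - f) ord)))) *\<^sub>R (\<Sum>i\<in>set (take (N - f) ord). y i)"
    by (auto simp: ce_step_def Let_def)
  define F where "F = set (take (N - f) ord)"
  define d where "d i = norm (y i - c)" for i
  have len: "length ord = N"
    using distinct_card[OF ord(1)] ord(2) by simp
  have cF: "card F = N - f"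
    unfolding F_def using ord(1) len by (subst distinct_card) auto
  have FN: "F \<subseteq> {1..N}"
    using ord(2) by (auto simp: F_def dest: in_set_takeD)
  have rest: "j \<in> set (drop (N - f) ord)" if "j \<in> {1..N} - F" for j
    using that ord(2) append_take_drop_id[of "N - f" ord]
    by (metis DiffD1 DiffD2 F_def Un_iff set_append)
  have "sorted (map (\<lambda>i. norm (c - y i)) (take (N - f) ord)
                @ map (\<lambda>i. norm (c - y i)) (drop (N - f) ord))"
    using ord(3) by (metis append_take_drop_id map_append)
  \<comment> \<open>Sortedness of a concatenation compares every kept agent with every discarded
    one; ties between distances do no harm.\<close>
  then have le: "d i \<le> d j" if "i \<in> F" "j \<in> {1..N} - F" for i j
    using that rest by (auto simp: sorted_append F_def d_def norm_minus_commute)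
  have fin: "finite F" "finite H"
    using FN H(1) finite_subset by auto
  have card_eq: "card (F - H) = card (H - F)"
    using fin cF H(2) by (metis Int_commute card_Diff_subset_Int finite_Int)
  then obtain p where p: "bij_betw p (F - H) (H - F)"
    using fin by (metis finite_Diff finite_same_card_bij)
  have dD: "(\<Sum>i\<in>F - H. d i) \<le> (\<Sum>j\<in>H - F. d j)"
  proof -
    have "(\<Sum>i\<in>F - H. d i) \<le> (\<Sum>i\<in>F - H. d (p i))"
      using H(1) bij_betwE[OF p] by (intro sum_mono le) auto
    also have "\<dots> = (\<Sum>j\<in>H - F. d j)"
      by (rule sum.reindex_bij_betw[OF p])
    finally show ?thesis .
  qed
  have cD: "card (H - F) \<le> f"
  proof -
    have "card (H - F) \<le> card ({1..N} - F)"
      using H(1) by (intro card_mono) auto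
    also have "\<dots> = f"
      using FN cF N fin by (simp add: card_Diff_subset)
    finally show ?thesis .
  qed
  let ?h = "real (N - f)"
  have h: "?h > 0"
    using N by simp
  have "z - c = (1 / ?h) *\<^sub>R (\<Sum>i\<in>F. y i - c)"
    using h cF ord(4) unfolding F_def[symmetric]
    by (simp add: sum_subtractf scaleR_diff_right sum_constant_scaleR)
  \<comment> \<open>Honest agents that were kept occur in both sums and cancel.\<close>
  moreover have "(\<Sum>i\<in>F. y i - c) - (\<Sum>i\<in>H. y i - c)
      = (\<Sum>i\<in>F - H. y i - c) - (\<Sum>i\<in>H - F. y i - c)"
    using fin by (simp add: sum.Int_Diff[of F _ H] sum.Int_Diff[of H _ F] Int_commute)
  ultimately have "z - c - (1 / ?h) *\<^sub>R (\<Sum>j\<in>H. y j - c)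
      = (1 / ?h) *\<^sub>R ((\<Sum>i\<in>F - H. y i - c) - (\<Sum>i\<in>H - F. y i - c))"
    by (metis scaleR_diff_right)
  also have "norm \<dots> = 1 / ?h * norm ((\<Sum>i\<in>F - H. y i - c) - (\<Sum>i\<in>H - F. y i - c))"
    by simp
  also have "\<dots> \<le> 1 / ?h * ((\<Sum>i\<in>F - H. d i) + (\<Sum>i\<in>H - F. d i))"
    unfolding d_def
    by (intro mult_left_mono order_trans[OF norm_triangle_ineq4] add_mono norm_sum) simp
  also have "\<dots> \<le> 1 / ?h * ((\<Sum>i\<in>H - F. d i) + (\<Sum>i\<in>H - F. d i))"
    using dD by (intro mult_left_mono add_mono) simp_all
  also have "\<dots> = 2 / ?h * (\<Sum>j\<in>H - F. d j)"
    by simp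
  finally show ?thesis
    using that[of "H - F"] cD by (simp add: d_def)
qed

text \<open>A bootstrap: as long as the drift is at most \<open>R\<close>, all gradients are at most
  \<open>L * (R + d)\<close>, and the steps made of such gradients and the noise again add up to at
  most \<open>R\<close>.\<close>

lemma local_drift:
  fixes u :: "nat \<Rightarrow> 'a::real_normed_vector"
  assumes step: "\<And>t. t < T \<Longrightarrow> u (Suc t) = u t - \<alpha> *\<^sub>R (g (u t) + \<xi> t)"
    and growth: "\<And>y. norm (g y) \<le> L * norm (y - s)"
    and "0 \<le> \<alpha>" "0 \<le> L" "\<alpha> * L * real T \<le> 1 / 72" "t \<le> T"
  shows "norm (u t - u 0) \<le> 72 / 71 * \<alpha> * (real T * L * norm (u 0 - s) + (\<Sum>t<T. norm (\<xi> t)))"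
proof -
  define d where "d = norm (u 0 - s)"
  \<comment> \<open>The factor is 72/71 = 1 / (1 - 1/72): the terms without feedback make up 71/72
    of \<open>R\<close>, and the feedback \<open>\<alpha> * L * real T * R\<close> fits into the
    remaining 1/72.\<close>
  define R where "R = 72 / 71 * \<alpha> * (real T * L * d + (\<Sum>t<T. norm (\<xi> t)))"
  have R0: "0 \<le> R"
    using assms(3,4) by (auto simp: R_def d_def intro!: mult_nonneg_nonneg add_nonneg_nonneg sum_nonneg)
  have partial: "\<alpha> * (real t * (L * R + L * d) + (\<Sum>s<t. norm (\<xi> s))) \<le> R" if "t \<le> T" for t
  proof -
    have "\<alpha> * (real t * (L * R + L * d) + (\<Sum>s<t. norm (\<xi> s)))
        \<le> \<alpha> * (real T * (L * R + L * d) + (\<Sum>s<T. norm (\<xi> s)))"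
      using that assms(3,4) R0
      by (intro mult_left_mono add_mono mult_right_mono sum_mono2) (auto simp: d_def)
    also have "\<dots> = \<alpha> * L * real T * R + 71 / 72 * R"
      by (simp add: R_def algebra_simps)
    also have "\<dots> \<le> 1 / 72 * R + 71 / 72 * R"
      using assms(5) R0 by (intro add_right_mono mult_right_mono)
    finally show ?thesis
      by simp
  qed
  \<comment> \<open>The induction carries the bound that grows with \<open>t\<close>; the uniform
    bound \<open>R\<close> alone would not be preserved by a further step.\<close>
  have "norm (u t - u 0) \<le> \<alpha> * (real t * (L * R + L * d) + (\<Sum>s<t. norm (\<xi> s)))"
    using \<open>t \<le> T\<close>
  proof (induction t)
    case 0
    then show ?case by simp
  next
    case (Suc t)
    then have IH: "norm (u t - u 0) \<le> \<alpha> * (real t * (L * R + L * d) + (\<Sum>s<t. norm (\<xi> s)))"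
      by simp
    then have "norm (u t - u 0) \<le> R"
      using partial[of t] Suc.prems by simp
    moreover have "norm (u t - s) \<le> norm (u t - u 0) + d"
      unfolding d_def using norm_triangle_ineq[of "u t - u 0" "u 0 - s"] by simp
    ultimately have gb: "norm (g (u t)) \<le> L * R + L * d"
      using order_trans[OF growth[of "u t"] mult_left_mono[of "norm (u t - s)" "R + d" L]] assms(4)
      by (simp add: distrib_left)
    have "u (Suc t) - u 0 = (u t - u 0) - \<alpha> *\<^sub>R (g (u t) + \<xi> t)"
      using step[of t] Suc.prems by simp
    also have "norm \<dots> \<le> norm (u t - u 0) + \<alpha> * norm (g (u t) + \<xi> t)"
      using norm_triangle_ineq4[of "u t - u 0" "\<alpha> *\<^sub>R (g (u t) + \<xi> t)"] assms(3) by simp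
    also have "\<dots> \<le> \<alpha> * (real t * (L * R + L * d) + (\<Sum>s<t. norm (\<xi> s)))
        + \<alpha> * (L * R + L * d + norm (\<xi> t))"
      using IH gb assms(3)
      by (intro add_mono mult_left_mono order_trans[OF norm_triangle_ineq]) auto
    also have "\<dots> = \<alpha> * (real (Suc t) * (L * R + L * d) + (\<Sum>s<Suc t. norm (\<xi> s)))"
      by (simp add: algebra_simps)
    finally show ?case .
  qed
  also have "\<dots> \<le> R"
    using partial \<open>t \<le> T\<close> by simp
  finally show ?thesis
    by (simp add: R_def d_def)
qed

text \<open>The difference of the two sides is a square over \<open>4 * e\<close>. The weight
  \<open>e\<close> fixes how much of the gradient term is spent on absorbing a mixed product of
  gradient and noise.\<close>

lemma weighted_amgm:
  fixes u v e :: real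
  assumes "0 < e"
  shows "u * v \<le> e * u\<^sup>2 + v\<^sup>2 / (4 * e)"
proof -
  have "e * u\<^sup>2 + v\<^sup>2 / (4 * e) - u * v = (2 * e * u - v)\<^sup>2 / (4 * e)"
    using assms by (simp add: field_simps power2_eq_square)
  also have "\<dots> \<ge> 0"
    using assms by simp
  finally show ?thesis
    by simp
qed

text \<open>
  Here \<open>G\<close> is the norm of the averaged gradient, \<open>\<delta>\<close> bounds the local drift, \<open>e\<close> the filtering error and
  \<open>B\<close> is the length of the server step; \<open>X\<close> and \<open>P\<close> are the total noise norms of all honest agents
  and of the discarded ones, divided by \<open>N - f\<close>, and \<open>gn\<close> is the linear noise term. Of the decrease
  \<open>\<alpha> T G\<^sup>2\<close>, at least an eighth survives:
  \<open>1 - 1/71 - 48/71 - 1/50 - 3/25 - 289/7200 > 1/8\<close>.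
\<close>

lemma descent_arith:
  fixes \<alpha> T L \<mu> G V V' gn \<delta> n e X P a B :: real
  assumes pos: "0 < \<alpha>" "1 \<le> T" "0 < L" "0 \<le> G" "0 \<le> P" "P \<le> X" "0 \<le> e"
    and a: "\<alpha> * L * T = a" "a \<le> 1 / 72"
    and \<delta>: "\<delta> \<le> T * G / 71 + 72 / 71 * a * X"
    and e: "e \<le> 48 / 71 * \<alpha> * T * G + 144 / 71 * \<alpha> * P"
    and V': "V' \<le> V + (- \<alpha> * T * G\<^sup>2 + \<alpha> * G * \<delta> - gn + G * e) + L / 2 * B\<^sup>2"
    and B: "0 \<le> B" "B \<le> \<alpha> * (T * G + \<delta> + X) + e"
    and PL: "2 * \<mu> * V \<le> G\<^sup>2"
  shows "V' \<le> (1 - \<alpha> * \<mu> * T / 4) * V - gn + 9 * \<alpha> * P\<^sup>2 / T + 10 * L * \<alpha>\<^sup>2 * X\<^sup>2"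
proof -
  have a0: "0 \<le> a"
    unfolding a(1)[symmetric] using pos by simp
  have X: "0 \<le> X"
    using pos by simp
  have 1: "\<alpha> * G * \<delta> \<le> \<alpha> * T * G\<^sup>2 / 71 + \<alpha> * (G * (72 / 71 * a * X))"
    using mult_left_mono[OF \<delta>, of "\<alpha> * G"] pos by (simp add: algebra_simps power2_eq_square)
  have 2: "G * e \<le> 48 / 71 * \<alpha> * T * G\<^sup>2 + \<alpha> * (G * (144 / 71 * P))"
    using mult_left_mono[OF e, of G] pos by (simp add: algebra_simps power2_eq_square)
  \<comment> \<open>The weight \<open>T / 50\<close> is the share 1/50 of the budget. One factor
    \<open>a\<close> in the resulting noise term is then replaced by 1/72, and the constant
    \<open>(72/71)^2 * 25 / 144\<close> is below 1/5.\<close>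
  have 3: "\<alpha> * (G * (72 / 71 * a * X)) \<le> \<alpha> * T * G\<^sup>2 / 50 + L * \<alpha>\<^sup>2 * X\<^sup>2 / 5"
  proof -
    have "G * (72 / 71 * a * X) \<le> T / 50 * G\<^sup>2 + (72 / 71 * a * X)\<^sup>2 / (4 * (T / 50))"
      using pos by (intro weighted_amgm) simp
    also have "(72 / 71 * a * X)\<^sup>2 / (4 * (T / 50)) = (72 / 71)\<^sup>2 * 25 / 2 * a * (\<alpha> * L) * X\<^sup>2"
      using pos unfolding a(1)[symmetric] by (simp add: field_simps power2_eq_square)
    also have "\<dots> = (72 / 71)\<^sup>2 * 25 / 2 * (\<alpha> * L * X\<^sup>2) * a"
      by simp
    also have "\<dots> \<le> (72 / 71)\<^sup>2 * 25 / 2 * (\<alpha> * L * X\<^sup>2) * (1 / 72)"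
      using pos a by (intro mult_left_mono) auto
    also have "\<dots> \<le> \<alpha> * L * X\<^sup>2 / 5"
      using pos by (simp add: field_simps)
    finally have "\<alpha> * (G * (72 / 71 * a * X)) \<le> \<alpha> * (T / 50 * G\<^sup>2 + \<alpha> * L * X\<^sup>2 / 5)"
      using pos by simp
    then show ?thesis
      by (simp add: algebra_simps power2_eq_square)
  qed
  \<comment> \<open>The weight \<open>3 / 25 * T\<close> is the share 3/25 of the budget; the noise
    constant \<open>(144/71)^2 * 25 / 12\<close> is below 9.\<close>
  have 4: "\<alpha> * (G * (144 / 71 * P)) \<le> 3 / 25 * \<alpha> * T * G\<^sup>2 + 9 * \<alpha> * P\<^sup>2 / T"
  proof -
    have "G * (144 / 71 * P) \<le> 3 / 25 * T * G\<^sup>2 + (144 / 71 * P)\<^sup>2 / (4 * (3 / 25 * T))"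
      using pos by (intro weighted_amgm) simp
    also have "(144 / 71 * P)\<^sup>2 / (4 * (3 / 25 * T)) \<le> 9 * P\<^sup>2 / T"
      using pos by (simp add: field_simps power2_eq_square)
    finally have "\<alpha> * (G * (144 / 71 * P)) \<le> \<alpha> * (3 / 25 * T * G\<^sup>2 + 9 * P\<^sup>2 / T)"
      using pos by simp
    then show ?thesis
      by (simp add: algebra_simps)
  qed
  have 5: "L / 2 * B\<^sup>2 \<le> \<alpha> * T * G\<^sup>2 * (289 / 7200) + 94 / 10 * L * \<alpha>\<^sup>2 * X\<^sup>2"
  proof -
    have aX: "a * X \<le> 1 / 72 * X"
      using a X by (intro mult_right_mono)
    have "B \<le> \<alpha> * (T * G + \<delta> + X) + (48 / 71 * \<alpha> * T * G + 144 / 71 * \<alpha> * P)"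
      using B e by simp
    also have "\<dots> = \<alpha> * (T * G + \<delta> + X + 48 / 71 * T * G + 144 / 71 * P)"
      by (simp add: algebra_simps)
    \<comment> \<open>The exact coefficients are 1 + 1/71 + 48/71 = 120/71 for \<open>T * G\<close>
      and, by \<open>a \<le> 1 / 72\<close> and \<open>P \<le> X\<close>, 1/71 + 1 + 144/71 = 216/71
      for \<open>X\<close>; both are rounded up.\<close>
    also have "\<dots> \<le> \<alpha> * (17 / 10 * (T * G) + 305 / 100 * X)"
    proof (rule mult_left_mono)
      have "0 \<le> T * G"
        using pos by simp
      then show "T * G + \<delta> + X + 48 / 71 * T * G + 144 / 71 * P \<le> 17 / 10 * (T * G) + 305 / 100 * X"
        using \<delta> aX X pos(6) by (simp add: mult.commute[of G])
    qed (use pos in simp)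
    finally have "B\<^sup>2 \<le> (\<alpha> * (17 / 10 * (T * G) + 305 / 100 * X))\<^sup>2"
      using B(1) by (intro power_mono)
    also have "\<dots> \<le> \<alpha>\<^sup>2 * (2 * (17 / 10 * (T * G))\<^sup>2 + 2 * (305 / 100 * X)\<^sup>2)"
      unfolding power_mult_distrib[of \<alpha>]
      by (intro mult_left_mono) (use sum_squares_bound[of "17 / 10 * (T * G)" "305 / 100 * X"] in
        \<open>auto simp: power2_sum\<close>)
    finally have "L / 2 * B\<^sup>2 \<le> L / 2 * (\<alpha>\<^sup>2 * (2 * (17 / 10 * (T * G))\<^sup>2 + 2 * (305 / 100 * X)\<^sup>2))"
      using pos by (intro mult_left_mono) auto
    also have "\<dots> = \<alpha> * T * G\<^sup>2 * (289 / 100) * a + 93025 / 10000 * L * \<alpha>\<^sup>2 * X\<^sup>2"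
      unfolding a(1)[symmetric] by (simp add: algebra_simps power2_eq_square)
    also have "\<dots> \<le> \<alpha> * T * G\<^sup>2 * (289 / 100) * (1 / 72) + 94 / 10 * L * \<alpha>\<^sup>2 * X\<^sup>2"
      using pos a by (intro add_mono mult_left_mono mult_right_mono) auto
    finally show ?thesis
      by simp
  qed
  have 6: "\<alpha> * T * (2 * \<mu> * V) \<le> \<alpha> * T * G\<^sup>2"
    using PL pos by (intro mult_left_mono) auto
  have "0 \<le> \<alpha> * T * G\<^sup>2" "0 \<le> L * \<alpha>\<^sup>2 * X\<^sup>2"
    using pos by auto
  \<comment> \<open>The noise contributions 1/5 and 94/10 from \<open>3\<close> and \<open>5\<close>
    are rounded up to 10.\<close>
  then have "V' \<le> V - gn + 9 * \<alpha> * P\<^sup>2 / T + 10 * (L * \<alpha>\<^sup>2 * X\<^sup>2) - \<alpha> * T * G\<^sup>2 / 8"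
    using V' 1 2 3 4 5 by (simp add: field_simps)
  \<comment> \<open>By \<open>6\<close> the surviving eighth of the gradient term is at least
    \<open>\<alpha> * \<mu> * T * V / 4\<close>, which gives the contraction factor.\<close>
  then show ?thesis
    using 6 by (simp add: algebra_simps)
qed

text \<open>One server round for a fixed realisation of the noise. The displacement
  \<open>z - c\<close> splits into an averaged gradient step, a drift error, the mean noise and the
  filtering error; each is bounded and the bounds go through smoothness of \<open>\<phi>\<close>
  into \<open>descent_arith\<close>. The linear noise term is kept exactly, because only its
  expectation vanishes.\<close>

lemma ce_local_sgd_descent:
  fixes c z s :: "'a::real_inner" and u \<xi> :: "nat \<Rightarrow> nat \<Rightarrow> 'a" and \<phi> :: "'a \<Rightarrow> real"
  assumes H: "H \<subseteq> {1..N}" "card H = N - f" and N: "f < N"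
    and init: "\<And>j. j \<in> H \<Longrightarrow> u j 0 = c"
    and step: "\<And>j t. j \<in> H \<Longrightarrow> t < T \<Longrightarrow> u j (Suc t) = u j t - \<alpha> *\<^sub>R (g j (u j t) + \<xi> j t)"
    and ce: "ce_step N f c y z" and y: "\<And>j. j \<in> H \<Longrightarrow> y j = u j T"
    and lip: "\<And>j. j \<in> H \<Longrightarrow> L-lipschitz_on UNIV (g j)"
    and zero: "\<And>j. j \<in> H \<Longrightarrow> g j s = 0"
    and deriv: "\<And>y. GDERIV \<phi> y :> (1 / real (N - f)) *\<^sub>R (\<Sum>j\<in>H. g j y)"
    and growth: "\<mu> * norm (c - s) \<le> norm ((1 / real (N - f)) *\<^sub>R (\<Sum>j\<in>H. g j c))"
    and PL: "2 * \<mu> * (\<phi> c - \<phi> s) \<le> (norm ((1 / real (N - f)) *\<^sub>R (\<Sum>j\<in>H. g j c)))\<^sup>2"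
    and L: "0 < L" "\<mu> \<le> L" and T: "1 \<le> T"
    and \<alpha>: "0 < \<alpha>" "\<alpha> \<le> \<mu> / (72 * L\<^sup>2 * real T)"
    and ratio: "real f / real (N - f) \<le> \<mu> / (3 * L)"
  shows "\<phi> z - \<phi> s \<le> (1 - \<alpha> * \<mu> * real T / 4) * (\<phi> c - \<phi> s)
     - \<alpha> * (((1 / real (N - f)) *\<^sub>R (\<Sum>j\<in>H. g j c)) \<bullet>
             ((1 / real (N - f)) *\<^sub>R (\<Sum>j\<in>H. \<Sum>t<T. \<xi> j t)))
     + (9 * \<alpha> * (real f / real (N - f)) / real T + 10 * L * \<alpha>\<^sup>2)
       * ((1 / real (N - f)) * (\<Sum>j\<in>H. (\<Sum>t<T. norm (\<xi> j t))\<^sup>2))"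
proof -
  define h where "h = real (N - f)"
  have h: "0 < h" "real (card H) = h"
    using N H by (auto simp: h_def)
  have fin: "finite H"
    using H(1) finite_subset by auto
  define a where "a = \<alpha> * L * real T"
  define \<Xi> where "\<Xi> j = (\<Sum>t<T. norm (\<xi> j t))" for j
  define gc where "gc = (1 / h) *\<^sub>R (\<Sum>j\<in>H. g j c)"
  define G where "G = norm gc"
  define d where "d = norm (c - s)"
  define n where "n = (1 / h) *\<^sub>R (\<Sum>j\<in>H. \<Sum>t<T. \<xi> j t)"
  define \<delta> where "\<delta> = (1 / h) *\<^sub>R (\<Sum>j\<in>H. \<Sum>t<T. g j (u j t) - g j c)"
  define X where "X = (1 / h) * (\<Sum>j\<in>H. \<Xi> j)"
  define W where "W = (1 / h) * (\<Sum>j\<in>H. (\<Xi> j)\<^sup>2)"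
  have \<Xi>0: "0 \<le> \<Xi> j" for j
    by (auto simp: \<Xi>_def intro: sum_nonneg)
  have G0: "0 \<le> G" and d0: "0 \<le> d" and a0: "0 \<le> a"
    using \<alpha> L by (auto simp: G_def d_def a_def)
  have growth': "\<mu> * d \<le> G"
    using growth by (simp add: G_def gc_def d_def h_def)
  have aL: "a * L \<le> \<mu> / 72"
    using \<alpha>(2) L T by (simp add: a_def field_simps power2_eq_square)
  \<comment> \<open>Here \<open>\<mu> \<le> L\<close> turns the step size condition into an absolute
    bound.\<close>
  have a72: "a \<le> 1 / 72"
  proof -
    have "a * L \<le> 1 / 72 * L"
      using aL L by linarith
    then show ?thesis
      using L(1) by (rule mult_right_le_imp_le)
  qed
  have aLd: "a * (L * d) \<le> G / 72"
    using mult_right_mono[OF aL d0] growth' by simp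
  \<comment> \<open>The bound on the Byzantine fraction meets the growth condition: the
    displacements of \<open>f\<close> agents, each of order \<open>L * d\<close>, cost only a third
    of \<open>G\<close> after averaging.\<close>
  have fLd: "real f / h * (L * d) \<le> G / 3"
  proof -
    have "real f / h * L \<le> \<mu> / 3"
      using mult_right_mono[OF ratio, of L] L by (simp add: h_def)
    then show ?thesis
      using mult_right_mono[of "real f / h * L" "\<mu> / 3" d] d0 growth' by simp
  qed
  have gb: "norm (g j v) \<le> L * norm (v - s)" if "j \<in> H" for j v
    using lipschitz_onD[OF lip[OF that], of v s] zero[OF that] by (simp add: dist_norm)
  have drift: "norm (u j t - c) \<le> 72 / 71 * \<alpha> * (real T * L * d + \<Xi> j)" if "j \<in> H" "t \<le> T" for j t
    using local_drift[of T "u j" \<alpha> "g j" "\<xi> j" L s t] step[OF that(1)] gb[OF that(1)] a72 \<alpha>(1) L that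
    by (simp add: init a_def d_def \<Xi>_def)
  have send: "u j t - c = - \<alpha> *\<^sub>R (\<Sum>i<t. g j (u j i) + \<xi> j i)" if "j \<in> H" "t \<le> T" for j t
    using that(2)
  proof (induction t)
    case 0
    then show ?case
      using init that by simp
  next
    case (Suc t)
    then have "u j (Suc t) - c = (u j t - c) - \<alpha> *\<^sub>R (g j (u j t) + \<xi> j t)"
      using step[OF that(1), of t] by simp
    with Suc show ?case
      by (simp add: scaleR_add_right)
  qed
  \<comment> \<open>The mean honest displacement is a gradient step of length
    \<open>\<alpha> * real T\<close>, perturbed by \<open>\<delta>\<close>, the deviation of the
    local gradients from their values at \<open>c\<close>, and by the mean noise
    \<open>n\<close>.\<close>
  have mean: "(1 / h) *\<^sub>R (\<Sum>j\<in>H. y j - c) = - \<alpha> *\<^sub>R (real T *\<^sub>R gc + \<delta> + n)"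
  proof -
    have "(\<Sum>j\<in>H. y j - c) = (\<Sum>j\<in>H. - \<alpha> *\<^sub>R (\<Sum>t<T. g j (u j t) + \<xi> j t))"
      using send y by (intro sum.cong) auto
    also have "\<dots> = - \<alpha> *\<^sub>R (\<Sum>j\<in>H. real T *\<^sub>R g j c + (\<Sum>t<T. g j (u j t) - g j c) + (\<Sum>t<T. \<xi> j t))"
      by (simp add: scaleR_sum_right[symmetric] sum_negf sum.distrib sum_subtractf sum_constant_scaleR)
    also have "\<dots> = - \<alpha> *\<^sub>R (h *\<^sub>R (real T *\<^sub>R gc + \<delta> + n))"
      using h by (simp add: sum.distrib gc_def \<delta>_def n_def scaleR_add_right scaleR_sum_right[symmetric])
    finally show ?thesis
      using h by simp
  qed
  obtain D where D: "D \<subseteq> H" "card D \<le> f"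
      "norm (z - c - (1 / h) *\<^sub>R (\<Sum>j\<in>H. y j - c)) \<le> 2 / h * (\<Sum>j\<in>D. norm (y j - c))"
    using ce_step_error[OF ce H N] unfolding h_def by blast
  define E where "E = z - c - (1 / h) *\<^sub>R (\<Sum>j\<in>H. y j - c)"
  define P where "P = (1 / h) * (\<Sum>j\<in>D. \<Xi> j)"
  have zc: "z - c = - \<alpha> *\<^sub>R (real T *\<^sub>R gc + \<delta> + n) + E"
    by (simp add: E_def mean)
  have P0: "0 \<le> P"
    unfolding P_def using h \<Xi>0 by (intro mult_nonneg_nonneg sum_nonneg) auto
  have PX: "P \<le> X"
    unfolding P_def X_def using D(1) fin h \<Xi>0 by (intro mult_left_mono sum_mono2) auto
  have "norm (\<Sum>j\<in>H. \<Sum>t<T. \<xi> j t) \<le> (\<Sum>j\<in>H. \<Xi> j)"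
    unfolding \<Xi>_def by (intro order_trans[OF norm_sum] sum_mono norm_sum)
  then have nX: "norm n \<le> X"
    using h by (simp add: n_def X_def divide_right_mono)
  \<comment> \<open>Each gradient deviates by at most \<open>L\<close> times the drift. Summing over
    the \<open>T\<close> local steps produces \<open>a\<close>, and \<open>aLd\<close> turns 72/71
    into 1/71.\<close>
  have \<delta>b: "norm \<delta> \<le> real T * G / 71 + 72 / 71 * a * X"
  proof -
    have "norm (\<Sum>j\<in>H. \<Sum>t<T. g j (u j t) - g j c)
        \<le> (\<Sum>j\<in>H. \<Sum>t<T. L * (72 / 71 * \<alpha> * (real T * L * d + \<Xi> j)))"
    proof (intro order_trans[OF norm_sum] sum_mono)
      fix j t assume jt: "j \<in> H" "t \<in> {..<T}"
      have "norm (g j (u j t) - g j c) \<le> L * norm (u j t - c)"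
        using lipschitz_onD[OF lip[OF jt(1)], of "u j t" c] by (simp add: dist_norm)
      also have "\<dots> \<le> L * (72 / 71 * \<alpha> * (real T * L * d + \<Xi> j))"
        using jt L by (intro mult_left_mono drift) auto
      finally show "norm (g j (u j t) - g j c) \<le> L * (72 / 71 * \<alpha> * (real T * L * d + \<Xi> j))" .
    qed
    also have "\<dots> = (\<Sum>j\<in>H. 72 / 71 * a * (real T * L * d + \<Xi> j))"
      by (simp add: a_def mult_ac)
    also have "\<dots> = 72 / 71 * a * (h * (real T * L * d) + (\<Sum>j\<in>H. \<Xi> j))"
      unfolding sum_distrib_left[symmetric] using h by (simp add: sum.distrib)
    also have "(\<Sum>j\<in>H. \<Xi> j) = h * X"
      using h by (simp add: X_def)
    finally have "(1 / h) * norm (\<Sum>j\<in>H. \<Sum>t<T. g j (u j t) - g j c)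
        \<le> (1 / h) * (72 / 71 * a * (h * (real T * L * d) + h * X))"
      using h by (intro mult_left_mono) auto
    then have "norm \<delta> \<le> (1 / h) * (72 / 71 * a * (h * (real T * L * d) + h * X))"
      using h by (simp add: \<delta>_def)
    also have "\<dots> = 72 / 71 * real T * (a * (L * d)) + 72 / 71 * a * X"
      using h by (simp add: field_simps)
    also have "\<dots> \<le> 72 / 71 * real T * (G / 72) + 72 / 71 * a * X"
      using aLd by (intro add_right_mono mult_left_mono) auto
    finally show ?thesis
      by (simp add: mult.commute)
  qed
  \<comment> \<open>The constants are 144/71 = 2 * 72/71, from the pairing and the drift, and 48/71,
    a third of it by \<open>fLd\<close>.\<close>
  have Eb: "norm E \<le> 48 / 71 * \<alpha> * real T * G + 144 / 71 * \<alpha> * P"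
  proof -
    have "norm E \<le> 2 / h * (\<Sum>j\<in>D. norm (y j - c))"
      using D(3) by (simp add: E_def)
    also have "\<dots> \<le> 2 / h * (\<Sum>j\<in>D. 72 / 71 * \<alpha> * (real T * L * d + \<Xi> j))"
      using h D(1) drift[of _ T] y by (intro mult_left_mono sum_mono) auto
    also have "\<dots> = 144 / 71 * \<alpha> * real T * (real (card D) / h * (L * d)) + 144 / 71 * \<alpha> * P"
      unfolding sum_distrib_left[symmetric] using h by (simp add: P_def sum.distrib field_simps)
    also have "\<dots> \<le> 144 / 71 * \<alpha> * real T * (real f / h * (L * d)) + 144 / 71 * \<alpha> * P"
      using D(2) h \<alpha> L d0 by (intro add_right_mono mult_left_mono mult_right_mono divide_right_mono) auto
    also have "\<dots> \<le> 144 / 71 * \<alpha> * real T * (G / 3) + 144 / 71 * \<alpha> * P"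
      using fLd \<alpha> by (intro add_right_mono mult_left_mono) auto
    finally show ?thesis
      by (simp add: mult_ac)
  qed
  have lip\<phi>: "L-lipschitz_on UNIV (\<lambda>y. (1 / h) *\<^sub>R (\<Sum>j\<in>H. g j y))"
  proof (rule lipschitz_onI)
    fix v w :: 'a
    have "dist ((1 / h) *\<^sub>R (\<Sum>j\<in>H. g j v)) ((1 / h) *\<^sub>R (\<Sum>j\<in>H. g j w))
        = 1 / h * norm (\<Sum>j\<in>H. g j v - g j w)"
      unfolding dist_norm scaleR_diff_right[symmetric] sum_subtractf[symmetric] using h by simp
    also have "\<dots> \<le> 1 / h * (\<Sum>j\<in>H. L * dist v w)"
      using h lipschitz_onD[OF lip, of _ v w]
      by (intro mult_left_mono order_trans[OF norm_sum] sum_mono) (auto simp: dist_norm)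
    also have "\<dots> = L * dist v w"
      using h by simp
    finally show "dist ((1 / h) *\<^sub>R (\<Sum>j\<in>H. g j v)) ((1 / h) *\<^sub>R (\<Sum>j\<in>H. g j w)) \<le> L * dist v w" .
  qed (use L in simp)
  have "\<phi> z \<le> \<phi> c + gc \<bullet> (z - c) + L / 2 * (norm (z - c))\<^sup>2"
    unfolding gc_def
    by (rule GDERIV_descent[where g = "\<lambda>y. (1 / h) *\<^sub>R (\<Sum>j\<in>H. g j y)", OF deriv[folded h_def] lip\<phi>])
  moreover have "gc \<bullet> (z - c) \<le> - \<alpha> * real T * G\<^sup>2 + \<alpha> * G * norm \<delta> - \<alpha> * (gc \<bullet> n) + G * norm E"
  proof -
    have "gc \<bullet> (z - c) = - \<alpha> * real T * G\<^sup>2 - \<alpha> * (gc \<bullet> \<delta>) - \<alpha> * (gc \<bullet> n) + gc \<bullet> E"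
      unfolding zc by (simp add: inner_add_right G_def power2_norm_eq_inner algebra_simps)
    moreover have "- (gc \<bullet> \<delta>) \<le> G * norm \<delta>"
      using norm_cauchy_schwarz[of "- gc" \<delta>] by (simp add: G_def)
    then have "\<alpha> * - (gc \<bullet> \<delta>) \<le> \<alpha> * (G * norm \<delta>)"
      using \<alpha> by (intro mult_left_mono) auto
    moreover have "gc \<bullet> E \<le> G * norm E"
      unfolding G_def by (rule norm_cauchy_schwarz)
    ultimately show ?thesis
      by simp
  qed
  ultimately have Vz: "\<phi> z - \<phi> s \<le> (\<phi> c - \<phi> s) + (- \<alpha> * real T * G\<^sup>2 + \<alpha> * G * norm \<delta>
      - \<alpha> * (gc \<bullet> n) + G * norm E) + L / 2 * (norm (z - c))\<^sup>2"
    by simp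
  have zb: "norm (z - c) \<le> \<alpha> * (real T * G + norm \<delta> + X) + norm E"
  proof -
    have "norm (real T *\<^sub>R gc + \<delta> + n) \<le> real T * G + norm \<delta> + X"
      using norm_triangle_ineq[of "real T *\<^sub>R gc + \<delta>" n] norm_triangle_ineq[of "real T *\<^sub>R gc" \<delta>] nX
      by (simp add: G_def)
    then have "norm (- \<alpha> *\<^sub>R (real T *\<^sub>R gc + \<delta> + n)) \<le> \<alpha> * (real T * G + norm \<delta> + X)"
      using \<alpha>(1) by simp
    then show ?thesis
      unfolding zc using norm_triangle_ineq[of "- \<alpha> *\<^sub>R (real T *\<^sub>R gc + \<delta> + n)" E] by linarith
  qed
  have "2 * \<mu> * (\<phi> c - \<phi> s) \<le> G\<^sup>2"
    using PL by (simp add: G_def gc_def h_def)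
  from descent_arith[OF \<alpha>(1) _ L(1) G0 P0 PX norm_ge_zero a_def[symmetric] a72 \<delta>b Eb Vz norm_ge_zero zb this]
  have "\<phi> z - \<phi> s \<le> (1 - \<alpha> * \<mu> * real T / 4) * (\<phi> c - \<phi> s) - \<alpha> * (gc \<bullet> n)
      + 9 * \<alpha> * P\<^sup>2 / real T + 10 * L * \<alpha>\<^sup>2 * X\<^sup>2"
    using T by simp
  moreover have "10 * L * \<alpha>\<^sup>2 * X\<^sup>2 \<le> 10 * L * \<alpha>\<^sup>2 * W"
  proof -
    have "X\<^sup>2 = (1 / h)\<^sup>2 * (\<Sum>j\<in>H. \<Xi> j)\<^sup>2"
      by (simp add: X_def power_mult_distrib power_divide)
    also have "\<dots> \<le> (1 / h)\<^sup>2 * ((\<Sum>j\<in>H. (\<Xi> j)\<^sup>2) * h)"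
      using sum_squared_le_sum_of_squares[of \<Xi> H] h by (intro mult_left_mono) auto
    also have "\<dots> = W"
      using h by (simp add: W_def power2_eq_square)
    finally show ?thesis
      using L \<alpha> by (intro mult_left_mono) auto
  qed
  \<comment> \<open>Cauchy-Schwarz over the at most \<open>f\<close> agents of \<open>D\<close>
    leaves the factor \<open>f / h\<close>, whereas the same argument over all of \<open>H\<close>
    leaves 1. This is the origin of the Byzantine fraction in the final noise level.\<close>
  moreover have "9 * \<alpha> * P\<^sup>2 / real T \<le> 9 * \<alpha> * (real f / h * W) / real T"
  proof -
    have "P\<^sup>2 = (1 / h)\<^sup>2 * (\<Sum>j\<in>D. \<Xi> j)\<^sup>2"
      by (simp add: P_def power_mult_distrib power_divide)
    also have "\<dots> \<le> (1 / h)\<^sup>2 * ((\<Sum>j\<in>H. (\<Xi> j)\<^sup>2) * real f)"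
    proof (rule mult_left_mono)
      have "(\<Sum>j\<in>D. \<Xi> j)\<^sup>2 \<le> (\<Sum>j\<in>D. (\<Xi> j)\<^sup>2) * real (card D)"
        by (rule sum_squared_le_sum_of_squares)
      also have "\<dots> \<le> (\<Sum>j\<in>H. (\<Xi> j)\<^sup>2) * real f"
        using D fin by (intro mult_mono sum_mono2 sum_nonneg) auto
      finally show "(\<Sum>j\<in>D. \<Xi> j)\<^sup>2 \<le> (\<Sum>j\<in>H. (\<Xi> j)\<^sup>2) * real f" .
    qed simp
    also have "\<dots> = real f / h * W"
      using h by (simp add: W_def power2_eq_square)
    finally show ?thesis
      using \<alpha> by (intro divide_right_mono mult_left_mono) auto
  qed
  ultimately have "\<phi> z - \<phi> s \<le> (1 - \<alpha> * \<mu> * real T / 4) * (\<phi> c - \<phi> s) - \<alpha> * (gc \<bullet> n)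
      + (9 * \<alpha> * (real f / h) / real T + 10 * L * \<alpha>\<^sup>2) * W"
    by (simp add: distrib_right)
  then show ?thesis
    by (simp only: gc_def n_def W_def h_def \<Xi>_def)
qed

subsection \<open>Second moments and orthogonality of the gradient noise\<close>

lemma integrable_mult_of_squares:
  fixes u v :: "'a \<Rightarrow> real"
  assumes [measurable]: "u \<in> borel_measurable M" "v \<in> borel_measurable M"
    and "integrable M (\<lambda>\<omega>. (u \<omega>)\<^sup>2)" "integrable M (\<lambda>\<omega>. (v \<omega>)\<^sup>2)"
  shows "integrable M (\<lambda>\<omega>. u \<omega> * v \<omega>)"
proof (rule Bochner_Integration.integrable_bound)
  show "integrable M (\<lambda>\<omega>. (u \<omega>)\<^sup>2 + (v \<omega>)\<^sup>2)"
    using assms by simp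
  have "\<bar>a * b\<bar> \<le> a\<^sup>2 + b\<^sup>2" for a b :: real
  proof -
    have "2 * (\<bar>a\<bar> * \<bar>b\<bar>) \<le> a\<^sup>2 + b\<^sup>2" "0 \<le> \<bar>a\<bar> * \<bar>b\<bar>"
      using sum_squares_bound[of "\<bar>a\<bar>" "\<bar>b\<bar>"] by (simp_all add: mult.assoc)
    then show ?thesis
      unfolding abs_mult by linarith
  qed
  then show "AE \<omega> in M. norm (u \<omega> * v \<omega>) \<le> norm ((u \<omega>)\<^sup>2 + (v \<omega>)\<^sup>2)"
    by (simp add: abs_of_nonneg)
qed simp

lemma integrable_norm_add_square:
  fixes u v :: "'a \<Rightarrow> 'b::{real_normed_vector, second_countable_topology}"
  assumes [measurable]: "u \<in> borel_measurable M" "v \<in> borel_measurable M"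
    and "integrable M (\<lambda>\<omega>. (norm (u \<omega>))\<^sup>2)" "integrable M (\<lambda>\<omega>. (norm (v \<omega>))\<^sup>2)"
  shows "integrable M (\<lambda>\<omega>. (norm (u \<omega> + v \<omega>))\<^sup>2)"
proof (rule Bochner_Integration.integrable_bound)
  show "integrable M (\<lambda>\<omega>. 2 * (norm (u \<omega>))\<^sup>2 + 2 * (norm (v \<omega>))\<^sup>2)"
    using assms by simp
  have "(norm (a + b))\<^sup>2 \<le> 2 * (norm a)\<^sup>2 + 2 * (norm b)\<^sup>2" for a b :: 'b
  proof -
    have "(norm (a + b))\<^sup>2 \<le> (norm a + norm b)\<^sup>2"
      by (intro power_mono norm_triangle_ineq) simp
    also have "\<dots> \<le> 2 * (norm a)\<^sup>2 + 2 * (norm b)\<^sup>2"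
      using sum_squares_bound[of "norm a" "norm b"] by (simp add: power2_sum)
    finally show ?thesis .
  qed
  then show "AE \<omega> in M. norm ((norm (u \<omega> + v \<omega>))\<^sup>2) \<le> norm (2 * (norm (u \<omega>))\<^sup>2 + 2 * (norm (v \<omega>))\<^sup>2)"
    by simp
qed simp

text \<open>Integrating the conditional bound with test function 1 bounds the unconditional second
  moment. Since this takes place in \<open>ennreal\<close>, integrability is a conclusion and not a
  premise.\<close>

lemma (in prob_space) stoch_grad_second_moment:
  assumes sub: "subalgebra M F" and sg: "stoch_grad M F h g D \<sigma>"
    and X: "X \<in> borel_measurable F"
    and meas: "(\<lambda>\<omega>. g (X \<omega>) (D \<omega>)) \<in> borel_measurable M" "grad h \<in> borel_measurable borel"
  shows "integrable M (\<lambda>\<omega>. (norm (g (X \<omega>) (D \<omega>) - grad h (X \<omega>)))\<^sup>2)"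
    and "expectation (\<lambda>\<omega>. (norm (g (X \<omega>) (D \<omega>) - grad h (X \<omega>)))\<^sup>2) \<le> \<sigma>\<^sup>2"
proof -
  interpret finite_measure_subalgebra M F
    by unfold_locales (rule sub)
  note [measurable] = meas measurable_from_subalg[OF sub X]
  let ?v = "\<lambda>\<omega>. (norm (g (X \<omega>) (D \<omega>) - grad h (X \<omega>)))\<^sup>2"
  have v[measurable]: "?v \<in> borel_measurable M"
    by measurable
  have "(\<integral>\<^sup>+ \<omega>. ennreal (?v \<omega>) \<partial>M) = (\<integral>\<^sup>+ \<omega>. nn_cond_exp M F (\<lambda>\<omega>. ennreal (?v \<omega>)) \<omega> \<partial>M)"
    using nn_cond_exp_intg[of "\<lambda>_. 1" "\<lambda>\<omega>. ennreal (?v \<omega>)"] by simp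
  also have "\<dots> \<le> (\<integral>\<^sup>+ \<omega>. ennreal (\<sigma>\<^sup>2) \<partial>M)"
    using sg X unfolding stoch_grad_def by (intro nn_integral_mono_AE) blast
  also have "\<dots> = ennreal (\<sigma>\<^sup>2)"
    by (simp add: emeasure_space_1)
  finally have le: "(\<integral>\<^sup>+ \<omega>. ennreal (?v \<omega>) \<partial>M) \<le> ennreal (\<sigma>\<^sup>2)" .
  then show int: "integrable M ?v"
    by (intro integrableI_bounded) (auto simp: less_top[symmetric] top_unique)
  show "expectation ?v \<le> \<sigma>\<^sup>2"
    using le int by (subst (asm) nn_integral_eq_integral) auto
qed

text \<open>Each component of \<open>Y\<close> is measurable for \<open>F\<close>, so in the
  expectation of a product the stochastic gradient may be replaced by its conditional mean, which is
  \<open>grad h (X \<omega>)\<close>.\<close>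

lemma (in prob_space) stoch_grad_orthogonal:
  fixes X Y :: "'a \<Rightarrow> real ^ 'n"
  assumes sub: "subalgebra M F" and sg: "stoch_grad M F h g D \<sigma>"
    and X: "X \<in> borel_measurable F" and Y: "Y \<in> borel_measurable F"
    and meas: "(\<lambda>\<omega>. g (X \<omega>) (D \<omega>)) \<in> borel_measurable M" "grad h \<in> borel_measurable borel"
    and sq: "integrable M (\<lambda>\<omega>. (norm (Y \<omega>))\<^sup>2)" "integrable M (\<lambda>\<omega>. (norm (grad h (X \<omega>)))\<^sup>2)"
  shows "has_bochner_integral M (\<lambda>\<omega>. Y \<omega> \<bullet> (g (X \<omega>) (D \<omega>) - grad h (X \<omega>))) 0"
proof -
  interpret finite_measure_subalgebra M F
    by unfold_locales (rule sub)
  note [measurable] = meas measurable_from_subalg[OF sub X] measurable_from_subalg[OF sub Y]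
  have [measurable]: "(\<lambda>v :: real ^ 'n. v $ j) \<in> borel_measurable borel" for j
    by (intro borel_measurable_continuous_onI continuous_intros)
  let ?\<xi> = "\<lambda>\<omega>. g (X \<omega>) (D \<omega>) - grad h (X \<omega>)"
  have comp_sq: "integrable M (\<lambda>\<omega>. (Z \<omega> $ j)\<^sup>2)"
    if [measurable]: "Z \<in> borel_measurable M" and "integrable M (\<lambda>\<omega>. (norm (Z \<omega>))\<^sup>2)"
    for Z :: "'a \<Rightarrow> real ^ 'n" and j
    by (rule Bochner_Integration.integrable_bound[OF that(2)])
       (auto intro!: AE_I2 simp: component_le_norm_cart abs_le_square_iff[symmetric])
  have "has_bochner_integral M (\<lambda>\<omega>. Y \<omega> $ j * ?\<xi> \<omega> $ j) 0" for j
  proof -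
    have YX: "integrable M (\<lambda>\<omega>. Y \<omega> $ j * grad h (X \<omega>) $ j)"
      using sq by (intro integrable_mult_of_squares comp_sq) measurable
    have Y\<xi>: "integrable M (\<lambda>\<omega>. Y \<omega> $ j * ?\<xi> \<omega> $ j)"
      using sq(1) stoch_grad_second_moment[OF sub sg X meas]
      by (intro integrable_mult_of_squares comp_sq) measurable
    \<comment> \<open>The exchange below needs integrability of this product only. It is the sum of
      two products of square integrable functions, so the stochastic gradient itself need not be
      integrable.\<close>
    have Yg: "integrable M (\<lambda>\<omega>. Y \<omega> $ j * g (X \<omega>) (D \<omega>) $ j)"
      using Bochner_Integration.integrable_add[OF YX Y\<xi>] by (simp add: algebra_simps)
    have Yj: "(\<lambda>\<omega>. Y \<omega> $ j) \<in> borel_measurable F"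
      using Y by measurable
    have "AE \<omega> in M. vec_cond_exp M F (\<lambda>\<omega>. g (X \<omega>) (D \<omega>)) \<omega> = grad h (X \<omega>)"
      using sg X unfolding stoch_grad_def by blast
    then have "AE \<omega> in M. real_cond_exp M F (\<lambda>\<omega>. g (X \<omega>) (D \<omega>) $ j) \<omega> = grad h (X \<omega>) $ j"
      by eventually_elim (simp add: vec_cond_exp_def vec_eq_iff)
    then have "expectation (\<lambda>\<omega>. Y \<omega> $ j * real_cond_exp M F (\<lambda>\<omega>. g (X \<omega>) (D \<omega>) $ j) \<omega>)
        = expectation (\<lambda>\<omega>. Y \<omega> $ j * grad h (X \<omega>) $ j)"
      by (intro integral_cong_AE) auto
    then have "expectation (\<lambda>\<omega>. Y \<omega> $ j * g (X \<omega>) (D \<omega>) $ j)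
        = expectation (\<lambda>\<omega>. Y \<omega> $ j * grad h (X \<omega>) $ j)"
      using real_cond_exp_intg(2)[OF Yg Yj] by simp
    then show ?thesis
      using Y\<xi> YX Yg by (simp add: has_bochner_integral_iff right_diff_distrib)
  qed
  then have "has_bochner_integral M (\<lambda>\<omega>. \<Sum>j\<in>UNIV. Y \<omega> $ j * ?\<xi> \<omega> $ j) (\<Sum>j\<in>(UNIV :: 'n set). 0)"
    by (intro has_bochner_integral_sum)
  then show ?thesis
    by (simp add: inner_vec_def)
qed

section \<open>Measurability with respect to the history\<close>

lemma measurable_history:
  fixes xb :: "nat \<Rightarrow> 'w \<Rightarrow> 'a::topological_space"
  shows measurable_history_global:
      "j \<le> k \<Longrightarrow> xb j \<in> borel_measurable (history M H xb x k t)"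
    and measurable_history_local:
      "\<lbrakk>i \<in> H; 1 \<le> s; s \<le> t\<rbrakk> \<Longrightarrow> x i k s \<in> borel_measurable (history M H xb x k t)"
proof -
  let ?G = "{xb j -` A \<inter> space M | j A. j \<le> k \<and> A \<in> sets borel} \<union>
      {x i k s -` A \<inter> space M | i s A. i \<in> H \<and> 1 \<le> s \<and> s \<le> t \<and> A \<in> sets borel}"
  have G: "?G \<subseteq> Pow (space M)"
    by auto
  have meas: "Z \<in> borel_measurable (history M H xb x k t)"
    if "\<And>A. A \<in> sets borel \<Longrightarrow> Z -` A \<inter> space M \<in> ?G" for Z :: "'w \<Rightarrow> 'a"
  proof (rule measurableI)
    fix A :: "'a set"
    assume "A \<in> sets borel"
    then show "Z -` A \<inter> space (history M H xb x k t) \<in> sets (history M H xb x k t)"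
      unfolding history_def space_measure_of[OF G] sets_measure_of[OF G]
      by (intro sigma_sets.Basic that)
  qed simp
  show "j \<le> k \<Longrightarrow> xb j \<in> borel_measurable (history M H xb x k t)"
    by (rule meas) blast
  show "\<lbrakk>i \<in> H; 1 \<le> s; s \<le> t\<rbrakk> \<Longrightarrow> x i k s \<in> borel_measurable (history M H xb x k t)"
    by (rule meas) blast
qed

lemma subalgebra_history:
  fixes xb :: "nat \<Rightarrow> 'w \<Rightarrow> 'a::topological_space"
  assumes "\<And>j. j \<le> k \<Longrightarrow> xb j \<in> borel_measurable M"
    and "\<And>i s. \<lbrakk>i \<in> H; 1 \<le> s; s \<le> t\<rbrakk> \<Longrightarrow> x i k s \<in> borel_measurable M"
  shows "subalgebra M (history M H xb x k t)"
  unfolding subalgebra_def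
proof
  show "space (history M H xb x k t) = space M"
    by (simp add: history_def space_measure_of_conv)
  let ?G = "{xb j -` A \<inter> space M | j A. j \<le> k \<and> A \<in> sets borel} \<union>
      {x i k s -` A \<inter> space M | i s A. i \<in> H \<and> 1 \<le> s \<and> s \<le> t \<and> A \<in> sets borel}"
  have "{xb j -` A \<inter> space M | j A. j \<le> k \<and> A \<in> sets borel} \<subseteq> sets M"
    using assms(1) by (blast intro: measurable_sets)
  moreover have "{x i k s -` A \<inter> space M | i s A. i \<in> H \<and> 1 \<le> s \<and> s \<le> t \<and> A \<in> sets borel} \<subseteq> sets M"
    using assms(2) by (blast intro: measurable_sets)
  ultimately have G: "?G \<subseteq> sets M"
    by (rule Un_least)
  then have "?G \<subseteq> Pow (space M)"
    using sets.space_closed by (rule order_trans)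
  then show "sets (history M H xb x k t) \<subseteq> sets M"
    unfolding history_def using sets.sigma_sets_subset[OF G] by (simp only: sets_measure_of)
qed

subsection \<open>Expected descent\<close>

lemma borel_measurable_GDERIV:
  fixes \<phi> :: "'a::real_inner \<Rightarrow> real"
  assumes "\<And>y. GDERIV \<phi> y :> g y"
  shows "\<phi> \<in> borel_measurable borel"
  using assms unfolding gderiv_def
  by (intro borel_measurable_continuous_onI continuous_at_imp_continuous_on)
     (auto intro: has_derivative_continuous)

lemma GDERIV_sum:
  assumes "\<And>i. i \<in> I \<Longrightarrow> GDERIV (q i) y :> g i"
  shows "GDERIV (\<lambda>y. \<Sum>i\<in>I. q i y) y :> (\<Sum>i\<in>I. g i)"
  using assms unfolding gderiv_def inner_sum_right by (intro has_derivative_sum)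

lemma GDERIV_avg_cost:
  assumes "\<And>i. i \<in> H \<Longrightarrow> GDERIV (q i) y :> g i"
  shows "GDERIV (avg_cost H q) y :> (1 / real (card H)) *\<^sub>R (\<Sum>i\<in>H. g i)"
proof -
  have "GDERIV (\<lambda>y. \<Sum>i\<in>H. q i y) y :> (\<Sum>i\<in>H. g i)"
    by (rule GDERIV_sum) (rule assms)
  then show ?thesis
    unfolding gderiv_def avg_cost_def[abs_def] inner_scaleR_right
    by (rule has_derivative_mult_right)
qed

text \<open>Both sums are stationary at \<open>s\<close>, and subtracting the two first-order
  conditions isolates the gradient of \<open>q i\<close>.\<close>

lemma redundancy_grad_zero:
  fixes q :: "nat \<Rightarrow> 'a::euclidean_space \<Rightarrow> real"
  assumes H: "finite H" "i \<in> H"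
    and diff: "\<And>j. j \<in> H \<Longrightarrow> q j differentiable (at s)"
    and min: "s \<in> argmin (\<lambda>y. \<Sum>j\<in>H. q j y)"
      "argmin (\<lambda>y. \<Sum>j\<in>H - {i}. q j y) = argmin (\<lambda>y. \<Sum>j\<in>H. q j y)"
  shows "grad (q i) s = 0"
proof -
  have zero: "(\<Sum>j\<in>A. grad (q j) s) = 0"
    if "A \<subseteq> H" "s \<in> argmin (\<lambda>y. \<Sum>j\<in>A. q j y)" for A
  proof -
    have "GDERIV (\<lambda>y. \<Sum>j\<in>A. q j y) s :> (\<Sum>j\<in>A. grad (q j) s)"
      using that(1) diff by (intro GDERIV_sum GDERIV_grad) auto
    then show ?thesis
      using that(2) by (rule GDERIV_minimizer)
  qed
  have "(\<Sum>j\<in>H. grad (q j) s) = grad (q i) s + (\<Sum>j\<in>H - {i}. grad (q j) s)"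
    by (rule sum.remove[OF H])
  then show ?thesis
    using zero[of H] zero[of "H - {i}"] min by auto
qed

text \<open>The value \<open>b / r\<close> is the fixed point of the map
  \<open>v \<mapsto> (1 - r) * v + b\<close>, and \<open>r \<le> 1\<close> makes this map
  monotone.\<close>

lemma linear_recursion_bound:
  fixes V :: "nat \<Rightarrow> real"
  assumes "\<And>k. V (Suc k) \<le> (1 - r) * V k + b" and "0 < r" "r \<le> 1" "0 \<le> b"
  shows "V k \<le> (1 - r) ^ k * V 0 + b / r"
proof (induction k)
  case 0
  then show ?case
    using assms by simp
next
  case (Suc k)
  have "V (Suc k) \<le> (1 - r) * ((1 - r) ^ k * V 0 + b / r) + b"
    using assms(1)[of k] mult_left_mono[OF Suc, of "1 - r"] assms(3) by simp
  also have "\<dots> = (1 - r) ^ Suc k * V 0 + b / r"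
    using assms(2) by (simp add: field_simps)
  finally show ?case .
qed

text \<open>Fixes one run of the algorithm. Redundancy appears through its consequence
  \<open>stationary\<close>.\<close>

locale ce_local_sgd = prob_space M for M :: "'w measure" +
  fixes S :: "'s measure" and N f T :: nat and H :: "nat set"
    and q :: "nat \<Rightarrow> real ^ 'n \<Rightarrow> real"
    and gQ :: "nat \<Rightarrow> real ^ 'n \<Rightarrow> 's \<Rightarrow> real ^ 'n"
    and \<Delta> :: "nat \<Rightarrow> nat \<Rightarrow> nat \<Rightarrow> 'w \<Rightarrow> 's"
    and xb :: "nat \<Rightarrow> 'w \<Rightarrow> real ^ 'n"
    and x :: "nat \<Rightarrow> nat \<Rightarrow> nat \<Rightarrow> 'w \<Rightarrow> real ^ 'n"
    and xs :: "real ^ 'n" and L \<mu> \<sigma> \<alpha> :: real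
  assumes agents: "f < N" "H \<subseteq> {1..N}" "card H = N - f"
    and diff: "\<And>i y. i \<in> H \<Longrightarrow> q i differentiable (at y)"
    and stationary: "\<And>i. i \<in> H \<Longrightarrow> grad (q i) xs = 0"
    and smooth: "L > 0" "\<And>i. i \<in> H \<Longrightarrow> L-lipschitz_on UNIV (grad (q i))"
    and PL: "\<mu> > 0"
          "\<And>y. (norm (grad (avg_cost H q) y))\<^sup>2 \<ge> 2 * \<mu> * (avg_cost H q y - avg_cost H q xs)"
          "\<And>y. 2 * \<mu> * (avg_cost H q y - avg_cost H q xs) \<ge> \<mu>\<^sup>2 * (norm (y - xs))\<^sup>2"
    and gQ_meas: "\<And>i. i \<in> H \<Longrightarrow> (\<lambda>(y, s). gQ i y s) \<in> borel \<Otimes>\<^sub>M S \<rightarrow>\<^sub>M borel"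
    and sample_meas: "\<And>i k t. i \<in> H \<Longrightarrow> t < T \<Longrightarrow> \<Delta> i k t \<in> M \<rightarrow>\<^sub>M S"
    and moments: "\<And>i k t. i \<in> H \<Longrightarrow> t < T \<Longrightarrow>
             stoch_grad M (history M H xb x k t) (q i) (gQ i) (\<Delta> i k t) \<sigma>"
    and server_meas: "\<And>k. xb k \<in> borel_measurable M"
    and init_integrable: "integrable M (\<lambda>\<omega>. avg_cost H q (xb 0 \<omega>))"
    and honest_init: "\<And>i k \<omega>. i \<in> H \<Longrightarrow> \<omega> \<in> space M \<Longrightarrow> x i k 0 \<omega> = xb k \<omega>"
    and honest_step: "\<And>i k t \<omega>. i \<in> H \<Longrightarrow> t < T \<Longrightarrow> \<omega> \<in> space M \<Longrightarrow>
          x i k (Suc t) \<omega> = x i k t \<omega> - \<alpha> *\<^sub>R gQ i (x i k t \<omega>) (\<Delta> i k t \<omega>)"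
    and server_step: "\<And>k \<omega>. \<omega> \<in> space M \<Longrightarrow>
          ce_step N f (xb k \<omega>) (\<lambda>i. x i k T \<omega>) (xb (Suc k) \<omega>)"
    and local_steps: "T \<ge> 1"
    and step_size: "0 < \<alpha>" "\<alpha> \<le> \<mu> / (72 * L\<^sup>2 * real T)"
    and ratio: "real f / real (N - f) \<le> \<mu> / (3 * L)"
begin

section \<open>Optimality gap, averaged gradient and noise of a run\<close>

definition gap :: "real ^ 'n \<Rightarrow> real" where
  "gap y = avg_cost H q y - avg_cost H q xs"

definition avg_grad :: "real ^ 'n \<Rightarrow> real ^ 'n" where
  "avg_grad y = (1 / real (N - f)) *\<^sub>R (\<Sum>j\<in>H. grad (q j) y)"

definition noise :: "nat \<Rightarrow> nat \<Rightarrow> nat \<Rightarrow> 'w \<Rightarrow> real ^ 'n" where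
  "noise k j t \<omega> = gQ j (x j k t \<omega>) (\<Delta> j k t \<omega>) - grad (q j) (x j k t \<omega>)"

lemma card_pos: "0 < real (N - f)"
  using agents by simp

lemma grad_growth: "i \<in> H \<Longrightarrow> norm (grad (q i) y) \<le> L * norm (y - xs)"
  using lipschitz_onD[OF smooth(2), of i y xs] stationary by (simp add: dist_norm)

lemma grad_measurable: "i \<in> H \<Longrightarrow> grad (q i) \<in> borel_measurable borel"
  using smooth(2) by (intro borel_measurable_continuous_onI lipschitz_on_continuous_on)

lemma avg_grad_measurable: "avg_grad \<in> borel_measurable borel"
  unfolding avg_grad_def[abs_def] using grad_measurable by measurable

lemma GDERIV_avg_grad: "GDERIV (avg_cost H q) y :> avg_grad y"
  unfolding avg_grad_def agents(3)[symmetric] by (intro GDERIV_avg_cost GDERIV_grad diff)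

lemma grad_avg_cost: "grad (avg_cost H q) y = avg_grad y"
  by (rule grad_eq[OF GDERIV_avg_grad])

lemma gap_PL: "2 * \<mu> * gap y \<le> (norm (avg_grad y))\<^sup>2"
  using PL(2) by (simp add: gap_def grad_avg_cost)

lemma gap_growth: "\<mu>\<^sup>2 * (norm (y - xs))\<^sup>2 \<le> 2 * \<mu> * gap y"
  using PL(3) by (simp add: gap_def)

lemma gap_nonneg: "0 \<le> gap y"
proof -
  have "0 \<le> 2 * \<mu> * gap y"
    using gap_growth[of y] by (meson order_trans zero_le_power2 mult_nonneg_nonneg)
  then show ?thesis
    using PL(1) by (simp add: zero_le_mult_iff)
qed

lemma gap_measurable: "gap \<in> borel_measurable borel"
  unfolding gap_def[abs_def] using borel_measurable_GDERIV[OF GDERIV_avg_grad] by measurable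

lemma avg_grad_growth: "\<mu> * norm (y - xs) \<le> norm (avg_grad y)"
proof (rule power2_le_imp_le)
  show "(\<mu> * norm (y - xs))\<^sup>2 \<le> (norm (avg_grad y))\<^sup>2"
    using gap_growth[of y] gap_PL[of y] by (simp add: power_mult_distrib)
qed simp

lemma avg_grad_le: "norm (avg_grad y) \<le> L * norm (y - xs)"
proof -
  have "norm (\<Sum>j\<in>H. grad (q j) y) \<le> (\<Sum>j\<in>H. L * norm (y - xs))"
    by (intro order_trans[OF norm_sum] sum_mono grad_growth)
  then show ?thesis
    using card_pos agents(3) by (simp add: avg_grad_def field_simps)
qed

text \<open>At a point at distance 1 from \<open>xs\<close> the averaged gradient has norm at least
  \<open>\<mu>\<close> and at most \<open>L\<close>.\<close>

lemma mu_le_L: "\<mu> \<le> L"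
proof -
  obtain v :: "real ^ 'n" where "norm v = 1"
    using vector_choose_size[of 1] by auto
  then show ?thesis
    using avg_grad_growth[of "v + xs"] avg_grad_le[of "v + xs"] by simp
qed

section \<open>Measurability and square integrability along a round\<close>

lemma local_measurable: "i \<in> H \<Longrightarrow> t \<le> T \<Longrightarrow> x i k t \<in> borel_measurable M"
  and sample_grad_measurable: "i \<in> H \<Longrightarrow> t < T \<Longrightarrow> (\<lambda>\<omega>. gQ i (x i k t \<omega>) (\<Delta> i k t \<omega>)) \<in> borel_measurable M"
proof -
  \<comment> \<open>Measurability of the iterate is a premise here, so that the induction for
    \<open>loc\<close> can use this fact for its own previous step.\<close>
  have smp: "(\<lambda>\<omega>. gQ i (x i k t \<omega>) (\<Delta> i k t \<omega>)) \<in> borel_measurable M"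
    if "i \<in> H" "t < T" "x i k t \<in> borel_measurable M" for t
    using measurable_compose[OF measurable_Pair[OF that(3) sample_meas[OF that(1,2), of k]] gQ_meas[OF that(1)]]
    by simp
  have loc: "x i k t \<in> borel_measurable M" if i: "i \<in> H" and "t \<le> T" for t
    using that(2)
  proof (induction t)
    case 0
    then show ?case
      using measurable_cong[of M "x i k 0" "xb k" borel] honest_init[OF i, of _ k] server_meas[of k] by auto
  next
    case (Suc t)
    then have [measurable]: "x i k t \<in> borel_measurable M"
      by simp
    have [measurable]: "(\<lambda>\<omega>. gQ i (x i k t \<omega>) (\<Delta> i k t \<omega>)) \<in> borel_measurable M"
      using Suc.prems by (intro smp i) auto
    have "(\<lambda>\<omega>. x i k t \<omega> - \<alpha> *\<^sub>R gQ i (x i k t \<omega>) (\<Delta> i k t \<omega>)) \<in> borel_measurable M"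
      by measurable
    then show ?case
      using measurable_cong[of M "x i k (Suc t)" _ borel] honest_step[OF i, of t _ k] Suc.prems by auto
  qed
  show "i \<in> H \<Longrightarrow> t \<le> T \<Longrightarrow> x i k t \<in> borel_measurable M"
    by (rule loc)
  show "i \<in> H \<Longrightarrow> t < T \<Longrightarrow> (\<lambda>\<omega>. gQ i (x i k t \<omega>) (\<Delta> i k t \<omega>)) \<in> borel_measurable M"
    using loc smp by simp
qed

lemma history_subalgebra: "t \<le> T \<Longrightarrow> subalgebra M (history M H xb x k t)"
  using server_meas local_measurable by (intro subalgebra_history) auto

lemma local_history:
  assumes "i \<in> H"
  shows "x i k t \<in> borel_measurable (history M H xb x k t)"
proof (cases "t = 0")
  \<comment> \<open>The history lists local iterates from \<open>s = 1\<close> on only; the initial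
    one agrees with \<open>xb k\<close> on the space and is covered by the global part.\<close>
  case True
  have "space (history M H xb x k t) = space M"
    by (simp add: history_def space_measure_of_conv)
  then show ?thesis
    using measurable_cong[of "history M H xb x k t" "x i k t" "xb k" borel]
      honest_init[OF assms, of _ k] measurable_history_global[of k k xb M H x t] True by auto
next
  case False
  then show ?thesis
    using assms by (intro measurable_history_local) auto
qed

lemma noise_measurable: "j \<in> H \<Longrightarrow> t < T \<Longrightarrow> noise k j t \<in> borel_measurable M"
  unfolding noise_def[abs_def]
  using sample_grad_measurable measurable_compose[OF local_measurable grad_measurable]
  by (intro borel_measurable_diff) auto

lemma noise_second_moment:
  assumes "j \<in> H" "t < T"
  shows "integrable M (\<lambda>\<omega>. (norm (noise k j t \<omega>))\<^sup>2)" "expectation (\<lambda>\<omega>. (norm (noise k j t \<omega>))\<^sup>2) \<le> \<sigma>\<^sup>2"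
  unfolding noise_def using assms
  by (intro stoch_grad_second_moment[OF history_subalgebra moments] local_history sample_grad_measurable
      grad_measurable; simp)+

text \<open>Quadratic growth bounds the squared distance of \<open>xb k\<close> to \<open>xs\<close>
  by a multiple of the gap. Each local step adds a gradient of linear growth and noise with finite
  second moment, so square integrability propagates through the round.\<close>

lemma local_square_integrable:
  assumes gap: "integrable M (\<lambda>\<omega>. gap (xb k \<omega>))" and j: "j \<in> H" and "t \<le> T"
  shows "integrable M (\<lambda>\<omega>. (norm (x j k t \<omega> - xs))\<^sup>2)"
  using \<open>t \<le> T\<close>
proof (induction t)
  case 0
  note [measurable] = server_meas
  have "integrable M (\<lambda>\<omega>. (norm (xb k \<omega> - xs))\<^sup>2)"
  proof (rule Bochner_Integration.integrable_bound)
    show "integrable M (\<lambda>\<omega>. 2 / \<mu> * gap (xb k \<omega>))"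
      using gap by simp
    show "AE \<omega> in M. norm ((norm (xb k \<omega> - xs))\<^sup>2) \<le> norm (2 / \<mu> * gap (xb k \<omega>))"
      using gap_growth gap_nonneg PL(1) by (simp add: field_simps power2_eq_square)
  qed simp
  moreover have "integrable M (\<lambda>\<omega>. (norm (x j k 0 \<omega> - xs))\<^sup>2) = integrable M (\<lambda>\<omega>. (norm (xb k \<omega> - xs))\<^sup>2)"
    by (intro Bochner_Integration.integrable_cong) (simp_all add: honest_init[OF j])
  ultimately show ?case
    by simp
next
  case (Suc t)
  then have IH: "integrable M (\<lambda>\<omega>. (norm (x j k t \<omega> - xs))\<^sup>2)" and t: "t < T"
    by auto
  note [measurable] = local_measurable[OF j less_imp_le[OF t]] noise_measurable[OF j t] grad_measurable[OF j]
  have "integrable M (\<lambda>\<omega>. (norm (grad (q j) (x j k t \<omega>)))\<^sup>2)"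
  proof (rule Bochner_Integration.integrable_bound)
    show "integrable M (\<lambda>\<omega>. L\<^sup>2 * (norm (x j k t \<omega> - xs))\<^sup>2)"
      using IH by simp
    show "AE \<omega> in M. norm ((norm (grad (q j) (x j k t \<omega>)))\<^sup>2) \<le> norm (L\<^sup>2 * (norm (x j k t \<omega> - xs))\<^sup>2)"
      using power_mono[OF grad_growth[OF j], of _ 2] by (simp add: power_mult_distrib)
  qed simp
  then have "integrable M (\<lambda>\<omega>. (norm (grad (q j) (x j k t \<omega>) + noise k j t \<omega>))\<^sup>2)"
    using noise_second_moment(1)[OF j t] by (intro integrable_norm_add_square) auto
  then have "integrable M (\<lambda>\<omega>. (norm ((x j k t \<omega> - xs) + - \<alpha> *\<^sub>R (grad (q j) (x j k t \<omega>) + noise k j t \<omega>)))\<^sup>2)"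
    using IH by (intro integrable_norm_add_square) (auto simp: power_mult_distrib)
  moreover have "integrable M (\<lambda>\<omega>. (norm (x j k (Suc t) \<omega> - xs))\<^sup>2) =
      integrable M (\<lambda>\<omega>. (norm ((x j k t \<omega> - xs) + - \<alpha> *\<^sub>R (grad (q j) (x j k t \<omega>) + noise k j t \<omega>)))\<^sup>2)"
    by (intro Bochner_Integration.integrable_cong) (simp_all add: honest_step[OF j t] noise_def algebra_simps)
  ultimately show ?case
    by simp
qed

text \<open>Every history of round \<open>k\<close> contains \<open>xb k\<close>, so the gradient at
  the start of the round is known at each local step \<open>t\<close> and is orthogonal to the noise
  drawn there.\<close>

lemma noise_orthogonal:
  assumes gap: "integrable M (\<lambda>\<omega>. gap (xb k \<omega>))" and j: "j \<in> H" and t: "t < T"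
  shows "has_bochner_integral M (\<lambda>\<omega>. avg_grad (xb k \<omega>) \<bullet> noise k j t \<omega>) 0"
  unfolding noise_def
proof (rule stoch_grad_orthogonal[where F = "history M H xb x k t" and h = "q j" and g = "gQ j"
      and X = "x j k t" and D = "\<Delta> j k t" and Y = "\<lambda>\<omega>. avg_grad (xb k \<omega>)"])
  show "subalgebra M (history M H xb x k t)"
    using t by (intro history_subalgebra) simp
  show "stoch_grad M (history M H xb x k t) (q j) (gQ j) (\<Delta> j k t) \<sigma>"
    by (rule moments[OF j t])
  show "x j k t \<in> borel_measurable (history M H xb x k t)"
    by (rule local_history[OF j])
  show "(\<lambda>\<omega>. avg_grad (xb k \<omega>)) \<in> borel_measurable (history M H xb x k t)"
    by (rule measurable_compose[OF measurable_history_global avg_grad_measurable]) simp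
  show "(\<lambda>\<omega>. gQ j (x j k t \<omega>) (\<Delta> j k t \<omega>)) \<in> borel_measurable M"
    by (rule sample_grad_measurable[OF j t])
  show "grad (q j) \<in> borel_measurable borel"
    by (rule grad_measurable[OF j])
  note [measurable] = server_meas avg_grad_measurable grad_measurable[OF j] local_measurable[OF j less_imp_le[OF t]]
  have sq: "integrable M (\<lambda>\<omega>. L\<^sup>2 * (norm (x j k t \<omega> - xs))\<^sup>2)" if "t \<le> T" for t
    using local_square_integrable[OF gap j that] by simp
  \<comment> \<open>As \<open>x j k 0\<close> equals \<open>xb k\<close>, the integrability shown
    for local iterates serves as the dominating bound with \<open>t = 0\<close>.\<close>
  show "integrable M (\<lambda>\<omega>. (norm (avg_grad (xb k \<omega>)))\<^sup>2)"
  proof (rule Bochner_Integration.integrable_bound[OF sq[of 0]])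
    have "norm ((norm (avg_grad (xb k \<omega>)))\<^sup>2) \<le> norm (L\<^sup>2 * (norm (x j k 0 \<omega> - xs))\<^sup>2)"
      if "\<omega> \<in> space M" for \<omega>
      using power_mono[OF avg_grad_le, of "xb k \<omega>" 2] honest_init[OF j that]
      by (simp add: power_mult_distrib)
    then show "AE \<omega> in M. norm ((norm (avg_grad (xb k \<omega>)))\<^sup>2) \<le> norm (L\<^sup>2 * (norm (x j k 0 \<omega> - xs))\<^sup>2)"
      by (rule AE_I2)
  qed simp_all
  show "integrable M (\<lambda>\<omega>. (norm (grad (q j) (x j k t \<omega>)))\<^sup>2)"
    using power_mono[OF grad_growth[OF j], of _ 2] t
    by (intro Bochner_Integration.integrable_bound[OF sq[of t]]) (auto simp: power_mult_distrib)
qed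

text \<open>The deterministic round estimate at \<open>\<omega>\<close>, with both noise terms
  expanded into sums over agents and local steps, so that expectations can be taken term by
  term.\<close>

lemma pathwise_descent:
  assumes "\<omega> \<in> space M"
  shows "gap (xb (Suc k) \<omega>) \<le> (1 - \<alpha> * \<mu> * real T / 4) * gap (xb k \<omega>)
     - \<alpha> / real (N - f) * (\<Sum>j\<in>H. \<Sum>t<T. avg_grad (xb k \<omega>) \<bullet> noise k j t \<omega>)
     + (9 * \<alpha> * (real f / real (N - f)) + 10 * L * \<alpha>\<^sup>2 * real T)
       * (1 / real (N - f) * (\<Sum>j\<in>H. \<Sum>t<T. (norm (noise k j t \<omega>))\<^sup>2))"
    (is "_ \<le> ?r * _ - _ * ?c + _")
proof -
  let ?h = "real (N - f)"
  let ?a = "9 * \<alpha> * (real f / ?h) / real T + 10 * L * \<alpha>\<^sup>2"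
  have "gap (xb (Suc k) \<omega>) \<le> ?r * gap (xb k \<omega>)
     - \<alpha> * (avg_grad (xb k \<omega>) \<bullet> ((1 / ?h) *\<^sub>R (\<Sum>j\<in>H. \<Sum>t<T. noise k j t \<omega>)))
     + (9 * \<alpha> * (real f / ?h) / real T + 10 * L * \<alpha>\<^sup>2)
       * ((1 / ?h) * (\<Sum>j\<in>H. (\<Sum>t<T. norm (noise k j t \<omega>))\<^sup>2))"
    unfolding gap_def avg_grad_def
  proof (rule ce_local_sgd_descent[where u = "\<lambda>j t. x j k t \<omega>", OF agents(2,3,1)])
    show "ce_step N f (xb k \<omega>) (\<lambda>j. x j k T \<omega>) (xb (Suc k) \<omega>)"
      by (rule server_step[OF assms])
    show "\<mu> * norm (xb k \<omega> - xs) \<le> norm ((1 / ?h) *\<^sub>R (\<Sum>j\<in>H. grad (q j) (xb k \<omega>)))"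
      using avg_grad_growth by (simp only: avg_grad_def)
    show "2 * \<mu> * (avg_cost H q (xb k \<omega>) - avg_cost H q xs)
        \<le> (norm ((1 / ?h) *\<^sub>R (\<Sum>j\<in>H. grad (q j) (xb k \<omega>))))\<^sup>2"
      using gap_PL by (simp only: avg_grad_def gap_def)
    show "GDERIV (avg_cost H q) y :> (1 / ?h) *\<^sub>R (\<Sum>j\<in>H. grad (q j) y)" for y
      using GDERIV_avg_grad by (simp only: avg_grad_def)
  qed (use assms honest_init honest_step smooth stationary mu_le_L local_steps step_size ratio in
      \<open>auto simp: noise_def\<close>)
  moreover have inner: "avg_grad (xb k \<omega>) \<bullet> ((1 / ?h) *\<^sub>R (\<Sum>j\<in>H. \<Sum>t<T. noise k j t \<omega>)) = 1 / ?h * ?c"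
    by (simp add: inner_sum_right)
  \<comment> \<open>Cauchy-Schwarz over the \<open>T\<close> local steps; \<open>weight\<close> then
    moves the factor \<open>T\<close> into the coefficient, where it cancels the division by
    \<open>T\<close>.\<close>
  moreover have "?a * (1 / ?h * (\<Sum>j\<in>H. (\<Sum>t<T. norm (noise k j t \<omega>))\<^sup>2))
      \<le> ?a * (1 / ?h * (real T * (\<Sum>j\<in>H. \<Sum>t<T. (norm (noise k j t \<omega>))\<^sup>2)))"
  proof (intro mult_left_mono)
    show "(\<Sum>j\<in>H. (\<Sum>t<T. norm (noise k j t \<omega>))\<^sup>2) \<le> real T * (\<Sum>j\<in>H. \<Sum>t<T. (norm (noise k j t \<omega>))\<^sup>2)"
      unfolding sum_distrib_left
      using sum_squared_le_sum_of_squares[of "\<lambda>t. norm (noise k _ t \<omega>)" "{..<T}"]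
      by (intro sum_mono) (simp add: mult.commute[of "real T"] sum_distrib_right)
  qed (use smooth(1) step_size(1) in auto)
  moreover have weight: "?a * (1 / ?h * (real T * w)) = (9 * \<alpha> * (real f / ?h) + 10 * L * \<alpha>\<^sup>2 * real T) * (1 / ?h * w)" for w
    using local_steps by (simp add: field_simps)
  moreover have "\<alpha> * (1 / ?h * ?c) = \<alpha> / ?h * ?c"
    by simp
  ultimately show ?thesis
    unfolding inner weight by linarith
qed

text \<open>The linear noise term integrates to 0 and each squared noise norm to at most
  \<open>\<sigma>\<^sup>2\<close>. Integrability of the gap is passed on to the next round, since it
  is what orthogonality there relies on.\<close>

lemma expected_descent:
  assumes gap: "integrable M (\<lambda>\<omega>. gap (xb k \<omega>))"
  shows "integrable M (\<lambda>\<omega>. gap (xb (Suc k) \<omega>))"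
    and "expectation (\<lambda>\<omega>. gap (xb (Suc k) \<omega>))
      \<le> (1 - \<alpha> * \<mu> * real T / 4) * expectation (\<lambda>\<omega>. gap (xb k \<omega>))
        + (9 * \<alpha> * (real f / real (N - f)) + 10 * L * \<alpha>\<^sup>2 * real T) * (real T * \<sigma>\<^sup>2)"
proof -
  let ?h = "real (N - f)"
  let ?r = "1 - \<alpha> * \<mu> * real T / 4"
  let ?b = "9 * \<alpha> * (real f / ?h) + 10 * L * \<alpha>\<^sup>2 * real T"
  define C where "C \<omega> = (\<Sum>j\<in>H. \<Sum>t<T. avg_grad (xb k \<omega>) \<bullet> noise k j t \<omega>)" for \<omega>
  define W where "W \<omega> = 1 / ?h * (\<Sum>j\<in>H. \<Sum>t<T. (norm (noise k j t \<omega>))\<^sup>2)" for \<omega>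
  define R where "R \<omega> = ?r * gap (xb k \<omega>) - \<alpha> / ?h * C \<omega> + ?b * W \<omega>" for \<omega>
  have "has_bochner_integral M C (\<Sum>j\<in>H. \<Sum>t<T. 0)"
    unfolding C_def using noise_orthogonal[OF gap] by (intro has_bochner_integral_sum) auto
  then have C: "integrable M C" "expectation C = 0"
    by (auto simp: has_bochner_integral_iff)
  have "has_bochner_integral M W (1 / ?h * (\<Sum>j\<in>H. \<Sum>t<T. expectation (\<lambda>\<omega>. (norm (noise k j t \<omega>))\<^sup>2)))"
    unfolding W_def
    by (intro has_bochner_integral_mult_right has_bochner_integral_sum has_bochner_integral_integrable
        noise_second_moment(1)) auto
  then have W: "integrable M W"
    and W_eq: "expectation W = 1 / ?h * (\<Sum>j\<in>H. \<Sum>t<T. expectation (\<lambda>\<omega>. (norm (noise k j t \<omega>))\<^sup>2))"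
    by (auto simp only: has_bochner_integral_iff)
  note W_eq
  also have "\<dots> \<le> 1 / ?h * (\<Sum>j\<in>H. \<Sum>t<T. \<sigma>\<^sup>2)"
    using noise_second_moment(2) by (intro mult_left_mono sum_mono) auto
  also have "\<dots> = real T * \<sigma>\<^sup>2"
    using card_pos agents(3) by simp
  finally have W_le: "expectation W \<le> real T * \<sigma>\<^sup>2" .
  have R: "integrable M R"
    unfolding R_def using gap C W by simp
  have le: "gap (xb (Suc k) \<omega>) \<le> R \<omega>" if "\<omega> \<in> space M" for \<omega>
    using pathwise_descent[OF that] by (simp only: R_def C_def W_def)
  note [measurable] = server_meas gap_measurable
  \<comment> \<open>The new gap lies between 0 and the integrable \<open>R\<close>, whatever the
    Byzantine agents have sent.\<close>
  show int: "integrable M (\<lambda>\<omega>. gap (xb (Suc k) \<omega>))"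
    using le gap_nonneg by (intro Bochner_Integration.integrable_bound[OF R] AE_I2) fastforce+
  have "expectation (\<lambda>\<omega>. gap (xb (Suc k) \<omega>)) \<le> expectation R"
    using le by (intro integral_mono int R)
  also have "\<dots> = ?r * expectation (\<lambda>\<omega>. gap (xb k \<omega>)) + ?b * expectation W"
    unfolding R_def using gap C W by simp
  also have "\<dots> \<le> ?r * expectation (\<lambda>\<omega>. gap (xb k \<omega>)) + ?b * (real T * \<sigma>\<^sup>2)"
    using W_le smooth(1) step_size by (intro add_left_mono mult_left_mono) auto
  finally show "expectation (\<lambda>\<omega>. gap (xb (Suc k) \<omega>))
      \<le> ?r * expectation (\<lambda>\<omega>. gap (xb k \<omega>)) + ?b * (real T * \<sigma>\<^sup>2)" .
qed

lemma gap_integrable: "integrable M (\<lambda>\<omega>. gap (xb k \<omega>))"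
proof (induction k)
  case 0
  then show ?case
    using init_integrable by (simp add: gap_def)
qed (rule expected_descent)

text \<open>Iterating the one-round bound gives the rate
  \<open>\<alpha> * \<mu> * real T / 4\<close> and the noise level \<open>?b / ?r\<close>; the rate
  is relaxed to 1/36 at the end.\<close>

lemma convergence:
  "expectation (\<lambda>\<omega>. gap (xb k \<omega>)) \<le> (1 - \<alpha> * \<mu> * real T / 36) ^ k * expectation (\<lambda>\<omega>. gap (xb 0 \<omega>))
     + 40 * L * real T * \<alpha> * \<sigma>\<^sup>2 / \<mu> + 36 * \<sigma>\<^sup>2 * real f / (\<mu> * real (N - f))"
proof -
  let ?r = "\<alpha> * \<mu> * real T / 4"
  let ?b = "(9 * \<alpha> * (real f / real (N - f)) + 10 * L * \<alpha>\<^sup>2 * real T) * (real T * \<sigma>\<^sup>2)"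
  have r: "0 < ?r" "?r \<le> 1"
  proof -
    show "0 < ?r"
      using step_size PL(1) local_steps by simp
    have "\<alpha> * \<mu> * real T \<le> \<mu> / (72 * L\<^sup>2 * real T) * \<mu> * real T"
      using step_size PL(1) by (intro mult_right_mono) auto
    also have "\<dots> = \<mu>\<^sup>2 / (72 * L\<^sup>2)"
      using local_steps by (simp add: power2_eq_square)
    also have "\<dots> \<le> L\<^sup>2 / (72 * L\<^sup>2)"
      using mu_le_L PL(1) by (intro divide_right_mono power_mono) auto
    also have "\<dots> \<le> 4"
      using smooth(1) by simp
    finally show "?r \<le> 1"
      by simp
  qed
  have "expectation (\<lambda>\<omega>. gap (xb k \<omega>)) \<le> (1 - ?r) ^ k * expectation (\<lambda>\<omega>. gap (xb 0 \<omega>)) + ?b / ?r"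
    using linear_recursion_bound[of "\<lambda>k. expectation (\<lambda>\<omega>. gap (xb k \<omega>))" ?r ?b k]
      expected_descent(2)[OF gap_integrable] r smooth(1) step_size(1) by simp
  \<comment> \<open>Dividing by the rate multiplies the weights 10 and 9 by 4.\<close>
  moreover have "?b / ?r = 40 * L * real T * \<alpha> * \<sigma>\<^sup>2 / \<mu> + 36 * \<sigma>\<^sup>2 * real f / (\<mu> * real (N - f))"
    using step_size(1) PL(1) local_steps card_pos by (simp add: field_simps power2_eq_square)
  \<comment> \<open>Relaxing the rate is monotone because \<open>1 - ?r\<close> and the initial
    expected gap are nonnegative.\<close>
  moreover have "(1 - ?r) ^ k * expectation (\<lambda>\<omega>. gap (xb 0 \<omega>))
      \<le> (1 - \<alpha> * \<mu> * real T / 36) ^ k * expectation (\<lambda>\<omega>. gap (xb 0 \<omega>))"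
    using r gap_nonneg by (intro mult_right_mono power_mono integral_nonneg) auto
  ultimately show ?thesis
    by simp
qed

end

section \<open>From the assumptions of the theorem to the setting of one run\<close>

theorem theorem1:
  fixes M :: "'w measure" and S :: "'s measure"
    and N f T :: nat and H :: "nat set"
    and q :: "nat \<Rightarrow> real ^ 'n \<Rightarrow> real"
    and gQ :: "nat \<Rightarrow> real ^ 'n \<Rightarrow> 's \<Rightarrow> real ^ 'n"
    and \<Delta> :: "nat \<Rightarrow> nat \<Rightarrow> nat \<Rightarrow> 'w \<Rightarrow> 's"
    and xb :: "nat \<Rightarrow> 'w \<Rightarrow> real ^ 'n"
    and x :: "nat \<Rightarrow> nat \<Rightarrow> nat \<Rightarrow> 'w \<Rightarrow> real ^ 'n"
    and xs :: "real ^ 'n" and L \<mu> \<sigma> \<alpha> :: real and k :: nat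
  assumes prob: "prob_space M"
    and agents: "1 \<le> f" "f < N" "H \<subseteq> {1..N}" "card H = N - f"
    and diff: "\<And>i y. i \<in> H \<Longrightarrow> q i differentiable (at y)"
    and redundancy: "\<And>A. A \<subseteq> H \<Longrightarrow> int (card A) \<ge> int N - 2 * int f \<Longrightarrow>
          argmin (\<lambda>y. \<Sum>i\<in>A. q i y) = argmin (\<lambda>y. \<Sum>i\<in>H. q i y)"
    and xs: "xs \<in> argmin (\<lambda>y. \<Sum>i\<in>H. q i y)"
    and smooth: "L > 0" "\<And>i. i \<in> H \<Longrightarrow> L-lipschitz_on UNIV (grad (q i))"
    and PL: "\<mu> > 0"
          "\<And>y. (norm (grad (avg_cost H q) y))\<^sup>2 \<ge> 2 * \<mu> * (avg_cost H q y - avg_cost H q xs)"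
          "\<And>y. 2 * \<mu> * (avg_cost H q y - avg_cost H q xs) \<ge> \<mu>\<^sup>2 * (norm (y - xs))\<^sup>2"
    and gQ_meas: "\<And>i. i \<in> H \<Longrightarrow> (\<lambda>(y, s). gQ i y s) \<in> borel \<Otimes>\<^sub>M S \<rightarrow>\<^sub>M borel"
    and indep: "prob_space.indep_vars M (\<lambda>_. S) (\<lambda>(i, k, t). \<Delta> i k t) (H \<times> UNIV \<times> {..<T})"
    and ident_distr: "\<And>i k t i' k' t'. i \<in> H \<Longrightarrow> t < T \<Longrightarrow> i' \<in> H \<Longrightarrow> t' < T \<Longrightarrow>
          distr M S (\<Delta> i k t) = distr M S (\<Delta> i' k' t')"
    and moments: "\<sigma> > 0"
          "\<And>i k t. i \<in> H \<Longrightarrow> t < T \<Longrightarrow>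
             stoch_grad M (history M H xb x k t) (q i) (gQ i) (\<Delta> i k t) \<sigma>"
    and server_meas: "\<And>k. xb k \<in> borel_measurable M"
    and init_integrable: "integrable M (\<lambda>\<omega>. avg_cost H q (xb 0 \<omega>))"
    and honest_init: "\<And>i k \<omega>. i \<in> H \<Longrightarrow> \<omega> \<in> space M \<Longrightarrow> x i k 0 \<omega> = xb k \<omega>"
    and honest_step: "\<And>i k t \<omega>. i \<in> H \<Longrightarrow> t < T \<Longrightarrow> \<omega> \<in> space M \<Longrightarrow>
          x i k (Suc t) \<omega> = x i k t \<omega> - \<alpha> *\<^sub>R gQ i (x i k t \<omega>) (\<Delta> i k t \<omega>)"
    and byzantine: "\<And>i k. i \<in> {1..N} - H \<Longrightarrow> x i k T \<in> borel_measurable M"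
    and server_step: "\<And>k \<omega>. \<omega> \<in> space M \<Longrightarrow>
          ce_step N f (xb k \<omega>) (\<lambda>i. x i k T \<omega>) (xb (Suc k) \<omega>)"
    and local_steps: "T \<ge> 1"
    and step_size: "0 < \<alpha>" "\<alpha> \<le> \<mu> / (72 * L\<^sup>2 * real T)"
    and ratio: "real f / real (N - f) \<le> \<mu> / (3 * L)"
  shows "integrable M (\<lambda>\<omega>. avg_cost H q (xb (k + 1) \<omega>) - avg_cost H q xs) \<and>
    prob_space.expectation M (\<lambda>\<omega>. avg_cost H q (xb (k + 1) \<omega>) - avg_cost H q xs)
      \<le> (1 - \<alpha> * \<mu> * real T / 36) ^ (k + 1)
            * prob_space.expectation M (\<lambda>\<omega>. avg_cost H q (xb 0 \<omega>) - avg_cost H q xs)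
          + 180 * L * real T * \<alpha> * \<sigma>\<^sup>2 / \<mu> + 72 * real T * \<sigma>\<^sup>2 * real f / (\<mu> * real (card H))"
proof -
  interpret prob_space M
    by (rule prob)
  \<comment> \<open>Measurability of the individual samples is part of the definition of an
    independent family.\<close>
  have sample: "\<Delta> i k t \<in> M \<rightarrow>\<^sub>M S" if "i \<in> H" "t < T" for i k t
    using indep that unfolding indep_vars_def2 by fastforce
  have "finite H"
    using agents(3) finite_subset by auto
  have stat: "grad (q i) xs = 0" if "i \<in> H" for i
  proof (rule redundancy_grad_zero[OF \<open>finite H\<close> that diff xs])
    \<comment> \<open>Redundancy applies to \<open>H - {i}\<close> since
      \<open>N - f - 1 \<ge> N - 2 * f\<close>; this is where \<open>1 \<le> f\<close>
      enters.\<close>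
    show "argmin (\<lambda>y. \<Sum>j\<in>H - {i}. q j y) = argmin (\<lambda>y. \<Sum>j\<in>H. q j y)"
      using agents that \<open>finite H\<close> by (intro redundancy) auto
  qed
  interpret ce_local_sgd M S N f T H q gQ \<Delta> xb x xs L \<mu> \<sigma> \<alpha>
    by unfold_locales
      (fact agents diff stat smooth PL gQ_meas sample moments(2) server_meas init_integrable
        honest_init honest_step server_step local_steps step_size ratio)+
  \<comment> \<open>The constants of \<open>convergence\<close> are relaxed to those claimed; the
    second comparison also uses \<open>T \<ge> 1\<close>.\<close>
  have "40 * (L * real T * \<alpha> * \<sigma>\<^sup>2 / \<mu>) \<le> 180 * (L * real T * \<alpha> * \<sigma>\<^sup>2 / \<mu>)"
    and "36 * (\<sigma>\<^sup>2 * real f / (\<mu> * real (card H))) \<le> 72 * (real T * (\<sigma>\<^sup>2 * real f / (\<mu> * real (card H))))"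
  proof -
    show "40 * (L * real T * \<alpha> * \<sigma>\<^sup>2 / \<mu>) \<le> 180 * (L * real T * \<alpha> * \<sigma>\<^sup>2 / \<mu>)"
      using smooth(1) step_size(1) PL(1) by (intro mult_right_mono) auto
    have "36 * 1 \<le> 72 * real T"
      using local_steps by simp
    then have "36 * 1 * (\<sigma>\<^sup>2 * real f / (\<mu> * real (card H)))
        \<le> 72 * real T * (\<sigma>\<^sup>2 * real f / (\<mu> * real (card H)))"
      using PL(1) by (intro mult_right_mono) auto
    then show "36 * (\<sigma>\<^sup>2 * real f / (\<mu> * real (card H)))
        \<le> 72 * (real T * (\<sigma>\<^sup>2 * real f / (\<mu> * real (card H))))"
      by simp
  qed
  \<comment> \<open>A Bochner integral defaults to 0 for functions that are not integrable;
    \<open>gap_integrable\<close> shows that the expectation on the left is a genuine one.\<close>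
  then show ?thesis
    using gap_integrable[of "k + 1"] convergence[of "k + 1"] agents(3) unfolding gap_def by simp
qed

end
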